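(* Let $U^n=(\mathbf f_1^n,\dots,\mathbf f_{N_v}^n,\mathbf E^n)$, $n\in\mathbb N$, be produced by the exponential (Lawson) DG scheme $$U^{n+1}=\exp(\Delta t\,L)\,U^n+\Delta t\,\exp(\Delta t\,L)\,N(U^n)$$ for the semi-discretized Vlasov-Ampère system (with $L$, $N$ and the expression of $\exp(tL)$ as given in the context), or by its generalization to high order Lawson Runge-Kutta methods (see context). Then the scheme preserves the discrete Poisson equation $$(A+\Pi)\,\mathbf E^n=-\sum_{j}(\mathbf 1-\Pi)\,\mathbf f_j^n\,\Delta v,\qquad \forall n\in\mathbb N,\ n\ge1,$$ provided that it is satisfied at the initial time $n=0$. Here $A$ is the DG matrix, $\Pi$ is the orthogonal projection onto $\mathrm{Ker}(A)$ and $\mathbf 1$ is the identity matrix of size $(k+1)N_x$.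
   Context: DG matrix. Let $k\ge 0$, $N_x\ge1$ be integers, $L_0>0$, $\Delta x=L_0/N_x$; the periodic interval $[0,L_0]$ is divided into $N_x$ cells $I_i$ of length $\Delta x$ with centers $x_i$, and on $I_i$ one uses the basis $\xi_i^m(x)=((x-x_i)/\Delta x)^m$, $m=0,\dots,k$. Put $\tilde N=(k+1)N_x$. A vector $\mathbf u\in\mathbb R^{\tilde N}$ is written as $\mathbf u=(\mathbf u_1,\dots,\mathbf u_{N_x})$, $\mathbf u_i=(u_i^0,\dots,u_i^k)\in\mathbb R^{k+1}$, and represents the piecewise polynomial $u_h|_{I_i}=\sum_m u_i^m\xi_i^m$. Define $(k+1)\times(k+1)$ matrices, for $\ell,m=1,\dots,k+1$, by $M_{\ell,m}=\frac{(1/2)^{m+\ell-1}}{m+\ell-1}[1-(-1)^{m+\ell-1}]$, $(D_1)_{\ell,m}=(1/2)^{m+\ell-2}\big(\frac{\ell-1}{m+\ell-2}-\frac12\big)[1-(-1)^{m+\ell-2}]$ with $(D_1)_{1,1}=0$, $(D_2)_{\ell,m}=(-1)^m(1/2)^{m+\ell-1}$, $(D_3)_{\ell,m}=(-1)^{\ell-1}(1/2)^{m+\ell-1}$. The DG matrix $A\in\mathbb R^{\tilde N\times\tilde N}$ (approximating $-\partial_x$ with central fluxes) is the block circulant matrix acting by $(A\mathbf u)_i=\frac1{\Delta x}M^{-1}(D_1\mathbf u_i+D_2\mathbf u_{i+1}+D_3\mathbf u_{i-1})$, cell indices modulo $N_x$. $\Pi\in\mathbb R^{\tilde N\times\tilde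 N}$ is the orthogonal projection onto $\mathrm{Ker}(A)$. Vlasov-Ampère semi-discretization. Let $v_{\max}>0$, $\Delta v=2v_{\max}/N_v$, $v_j=-v_{\max}+j\Delta v$, $j=1,\dots,N_v$. The unknowns are $\mathbf f_j\in\mathbb R^{\tilde N}$ ($j=1,\dots,N_v$) and $\mathbf E\in\mathbb R^{\tilde N}$ (DG coefficients of $f(\cdot,v_j)$ and of the electric field $E$). For $\mathbf E=(E_i^n)$, $\tilde{\mathbf E}$ is the $\tilde N\times\tilde N$ block diagonal matrix with diagonal blocks $(\Delta x M)^{-1}B_i$, $(B_i)_{\ell,m}=\int_{I_i}\big(\sum_{n=0}^kE_i^n\xi_i^n\big)\xi_i^m\xi_i^\ell\,dx$, $\ell,m=0,\dots,k$. $\mathcal D$ is a linear (central) finite difference operator in the velocity index approximating $\partial_v$ (acting on each DG coefficient), conservative in the sense that $\sum_{j}(\mathcal D\mathbf f)_j=0$. The semi-discrete system is $$\partial_t\mathbf f_j=v_jA\mathbf f_j-\tilde{\mathbf E}(\mathcal D\mathbf f)_j,\qquad \partial_t\mathbf E=-\sum_{j}v_j(\mathbf 1-\Pi)\mathbf f_j\,\Delta v,$$ written $\partial_tU=LU+N(U)$ with $U=(\mathbf f_1,\dots,\mathbf f_{N_v},\mathbf E)$, $L U=\big(v_1A\mathbf f_1,\dots,v_{N_v}A\mathbf f_{N_v},-\Delta v\sum_jv_j(\mathbf 1-\Pi)\mathbf f_j\big)$ and $N(U)=\big(-\tilde{\mathbf E}(\mathcal D\mathbf f)_1,\dots,-\tilde{\mathbf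 E}(\mathcal D\mathbf f)_{N_v},0\big)$. The scheme uses the expression $$\exp(tL)U=\Big(e^{v_1At}\mathbf f_1,\dots,e^{v_{N_v}At}\mathbf f_{N_v},\ \mathbf E+\Delta v\sum_j(A+\Pi)^{-1}(\mathbf 1-e^{v_jAt})\mathbf f_j\Big).$$ $\Delta t>0$ is the time step. Lawson Runge-Kutta schemes. For an explicit Runge-Kutta method with $s$ stages and Butcher coefficients $(a_{pq})_{q<p},(b_p),(c_p)$: $U^{(p)}=e^{c_p\Delta tL}U^n+\Delta t\sum_{q<p}a_{pq}e^{(c_p-c_q)\Delta tL}N(U^{(q)})$ for $p=1,\dots,s$, and $U^{n+1}=e^{\Delta tL}U^n+\Delta t\sum_{p=1}^sb_pe^{(1-c_p)\Delta tL}N(U^{(p)})$.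
   Formalization: The orthogonal projection Π onto Ker(A) is taken orthogonal for the L² inner product of the represented piecewise polynomials; with the Euclidean product on coefficient vectors the claim fails for k ≥ 2, and for k ≤ 1 the two projections coincide. *)

theory Defs
  imports
    "HOL-Analysis.Analysis"
    "HOL-Library.FuncSet"
    "Jordan_Normal_Form.Gauss_Jordan_Elimination"
    "Jordan_Normal_Form.Matrix_Kernel"
begin

unbundle no vec_syntax
hide_const (open) Finite_Cartesian_Product.vec Finite_Cartesian_Product.mat

section \<open>Matrices and vectors\<close>

definition minv :: "real mat \<Rightarrow> real mat" where
  "minv B = the (mat_inverse B)"

definition mat_exp :: "real mat \<Rightarrow> real mat" where
  "mat_exp B = mat (dim_row B) (dim_row B)
     (\<lambda>(r, c). \<Sum>p. (B ^\<^sub>m p) $$ (r, c) / fact p)"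

definition vsum :: "nat \<Rightarrow> (nat \<Rightarrow> real vec) \<Rightarrow> nat set \<Rightarrow> real vec" where
  "vsum n w S = vec n (\<lambda>r. \<Sum>j\<in>S. w j $ r)"

definition orthogonal_projection_onto ::
  "(real vec \<Rightarrow> real vec \<Rightarrow> real) \<Rightarrow> nat \<Rightarrow> real vec set \<Rightarrow> real mat \<Rightarrow> bool" where
  "orthogonal_projection_onto ip n K P \<longleftrightarrow>
     P \<in> carrier_mat n n \<and>
     (\<forall>u\<in>carrier_vec n. P *\<^sub>v u \<in> K \<and> (\<forall>w\<in>K. ip (u - P *\<^sub>v u) w = 0))"


section \<open>The discontinuous Galerkin matrix\<close>

text \<open>
  Cells and polynomial degrees are numbered from 0: cell \<open>i < Nx\<close> is
  \<open>[i \<Delta>x, (i + 1) \<Delta>x]\<close>, and the coefficient of \<open>\<xi>\<^sub>i\<^sup>m\<close>, \<open>m \<le> k\<close>, is stored at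
  position \<open>i * (k + 1) + m\<close>. The \<open>(k + 1) \<times> (k + 1)\<close> matrices are the usual
  one-based formulas with \<open>l\<close>, \<open>m\<close> replaced by \<open>l + 1\<close>, \<open>m + 1\<close>.
\<close>

definition dg_dim :: "nat \<Rightarrow> nat \<Rightarrow> nat" where
  "dg_dim k Nx = (k + 1) * Nx"

definition cell_size :: "nat \<Rightarrow> real \<Rightarrow> real" where
  "cell_size Nx L0 = L0 / real Nx"

definition cell :: "nat \<Rightarrow> real \<Rightarrow> nat \<Rightarrow> real set" where
  "cell Nx L0 i = {real i * cell_size Nx L0 .. (real i + 1) * cell_size Nx L0}"

definition basis_fun :: "nat \<Rightarrow> real \<Rightarrow> nat \<Rightarrow> nat \<Rightarrow> real \<Rightarrow> real" where
  "basis_fun Nx L0 i m x =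
     ((x - (real i + 1/2) * cell_size Nx L0) / cell_size Nx L0) ^ m"

text \<open>The restriction to cell \<open>i\<close> of the piecewise polynomial with coefficient vector \<open>u\<close>.\<close>

definition dg_fun :: "nat \<Rightarrow> nat \<Rightarrow> real \<Rightarrow> real vec \<Rightarrow> nat \<Rightarrow> real \<Rightarrow> real" where
  "dg_fun k Nx L0 u i x = (\<Sum>m\<le>k. u $ (i * (k + 1) + m) * basis_fun Nx L0 i m x)"

text \<open>The \<open>L\<^sup>2(0, L0)\<close> inner product of the piecewise polynomials represented by \<open>u\<close> and \<open>w\<close>.
  Projections onto the kernel of the DG matrix are orthogonal for this product, not for
  the Euclidean product of coefficient vectors: the range of the DG matrix is
  \<open>L\<^sup>2\<close>-orthogonal to its kernel, but for \<open>k \<ge> 2\<close> not Euclidean-orthogonal to it.\<close>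

definition dg_inner :: "nat \<Rightarrow> nat \<Rightarrow> real \<Rightarrow> real vec \<Rightarrow> real vec \<Rightarrow> real" where
  "dg_inner k Nx L0 u w =
     (\<Sum>i<Nx. integral (cell Nx L0 i) (\<lambda>x. dg_fun k Nx L0 u i x * dg_fun k Nx L0 w i x))"

definition mass_mat :: "nat \<Rightarrow> real mat" where
  "mass_mat k = mat (k + 1) (k + 1) (\<lambda>(l, m).
     (1/2) ^ (l + m + 1) / real (l + m + 1) * (1 - (-1) ^ (l + m + 1)))"

definition D1_mat :: "nat \<Rightarrow> real mat" where
  "D1_mat k = mat (k + 1) (k + 1) (\<lambda>(l, m).
     if l = 0 \<and> m = 0 then 0
     else (1/2) ^ (l + m) * (real l / real (l + m) - 1/2) * (1 - (-1) ^ (l + m)))"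

definition D2_mat :: "nat \<Rightarrow> real mat" where
  "D2_mat k = mat (k + 1) (k + 1) (\<lambda>(l, m). (-1) ^ (m + 1) * (1/2) ^ (l + m + 1))"

definition D3_mat :: "nat \<Rightarrow> real mat" where
  "D3_mat k = mat (k + 1) (k + 1) (\<lambda>(l, m). (-1) ^ l * (1/2) ^ (l + m + 1))"

text \<open>
  The contributions are added because, for \<open>Nx \<le> 2\<close>, some of the cells
  \<open>i\<close>, \<open>i + 1\<close>, \<open>i - 1\<close> coincide modulo \<open>Nx\<close>.
\<close>

definition dg_mat :: "nat \<Rightarrow> nat \<Rightarrow> real \<Rightarrow> real mat" where
  "dg_mat k Nx L0 = mat (dg_dim k Nx) (dg_dim k Nx) (\<lambda>(r, c).
     let i = r div (k + 1); l = r mod (k + 1);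
         i' = c div (k + 1); m = c mod (k + 1)
     in 1 / cell_size Nx L0 *
        ((if i' = i then (minv (mass_mat k) * D1_mat k) $$ (l, m) else 0)
       + (if i' = (i + 1) mod Nx then (minv (mass_mat k) * D2_mat k) $$ (l, m) else 0)
       + (if i' = (i + Nx - 1) mod Nx then (minv (mass_mat k) * D3_mat k) $$ (l, m) else 0)))"


section \<open>The semi-discrete Vlasov--Ampere system\<close>

text \<open>
  A state \<open>U = (f, E)\<close> consists of the coefficient vectors \<open>f j\<close>, \<open>j \<in> {1..Nv}\<close>,
  and \<open>E\<close>; outside \<open>{1..Nv}\<close> the function \<open>f\<close> is \<open>undefined\<close>.
\<close>

type_synonym state = "(nat \<Rightarrow> real vec) \<times> real vec"

definition states :: "nat \<Rightarrow> nat \<Rightarrow> nat \<Rightarrow> state set" where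
  "states k Nx Nv =
     ({1..Nv} \<rightarrow>\<^sub>E carrier_vec (dg_dim k Nx)) \<times> carrier_vec (dg_dim k Nx)"

definition state_add :: "nat \<Rightarrow> state \<Rightarrow> state \<Rightarrow> state" where
  "state_add Nv U W = ((\<lambda>j\<in>{1..Nv}. fst U j + fst W j), snd U + snd W)"

definition state_scale :: "nat \<Rightarrow> real \<Rightarrow> state \<Rightarrow> state" where
  "state_scale Nv t U = ((\<lambda>j\<in>{1..Nv}. t \<cdot>\<^sub>v fst U j), t \<cdot>\<^sub>v snd U)"

definition state_sum :: "nat \<Rightarrow> nat \<Rightarrow> nat \<Rightarrow> (nat \<Rightarrow> state) \<Rightarrow> nat set \<Rightarrow> state" where
  "state_sum k Nx Nv W S =
     ((\<lambda>j\<in>{1..Nv}. vsum (dg_dim k Nx) (\<lambda>q. fst (W q) j) S),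
      vsum (dg_dim k Nx) (\<lambda>q. snd (W q)) S)"

definition vel_step :: "nat \<Rightarrow> real \<Rightarrow> real" where
  "vel_step Nv vmax = 2 * vmax / real Nv"

definition vel :: "nat \<Rightarrow> real \<Rightarrow> nat \<Rightarrow> real" where
  "vel Nv vmax j = - vmax + real j * vel_step Nv vmax"

text \<open>
  \<open>field_mat k Nx L0 E\<close> is the block diagonal matrix with diagonal blocks
  \<open>(\<Delta>x M)\<^sup>-\<^sup>1 B\<^sub>i\<close>.
\<close>

definition field_block :: "nat \<Rightarrow> nat \<Rightarrow> real \<Rightarrow> real vec \<Rightarrow> nat \<Rightarrow> real mat" where
  "field_block k Nx L0 E i = mat (k + 1) (k + 1) (\<lambda>(l, m).
     integral (cell Nx L0 i)
       (\<lambda>x. dg_fun k Nx L0 E i x * basis_fun Nx L0 i m x * basis_fun Nx L0 i l x))"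

definition field_mat :: "nat \<Rightarrow> nat \<Rightarrow> real \<Rightarrow> real vec \<Rightarrow> real mat" where
  "field_mat k Nx L0 E = mat (dg_dim k Nx) (dg_dim k Nx) (\<lambda>(r, c).
     if r div (k + 1) = c div (k + 1)
     then (minv (cell_size Nx L0 \<cdot>\<^sub>m mass_mat k) * field_block k Nx L0 E (r div (k + 1)))
            $$ (r mod (k + 1), c mod (k + 1))
     else 0)"

text \<open>
  A linear operator in the velocity index that acts on each coefficient separately
  is given by its weights \<open>d j l\<close>.
\<close>

definition vel_diff ::
  "nat \<Rightarrow> nat \<Rightarrow> nat \<Rightarrow> (nat \<Rightarrow> nat \<Rightarrow> real) \<Rightarrow> (nat \<Rightarrow> real vec) \<Rightarrow> nat \<Rightarrow> real vec" where
  "vel_diff k Nx Nv d f j = vsum (dg_dim k Nx) (\<lambda>l. d j l \<cdot>\<^sub>v f l) {1..Nv}"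

definition conservative :: "nat \<Rightarrow> nat \<Rightarrow> nat \<Rightarrow> (nat \<Rightarrow> nat \<Rightarrow> real) \<Rightarrow> bool" where
  "conservative k Nx Nv d \<longleftrightarrow>
     (\<forall>f \<in> {1..Nv} \<rightarrow>\<^sub>E carrier_vec (dg_dim k Nx).
        vsum (dg_dim k Nx) (vel_diff k Nx Nv d f) {1..Nv} = 0\<^sub>v (dg_dim k Nx))"

definition nonlin ::
  "nat \<Rightarrow> nat \<Rightarrow> real \<Rightarrow> nat \<Rightarrow> (nat \<Rightarrow> nat \<Rightarrow> real) \<Rightarrow> state \<Rightarrow> state" where
  "nonlin k Nx L0 Nv d U =
     ((\<lambda>j\<in>{1..Nv}. - (field_mat k Nx L0 (snd U) *\<^sub>v vel_diff k Nx Nv d (fst U) j)),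
      0\<^sub>v (dg_dim k Nx))"

text \<open>
  The flow \<open>exp(t L)\<close> of the linear part
  \<open>L U = (v\<^sub>1 A f\<^sub>1, \<dots>, - \<Delta>v \<Sum>\<^sub>j v\<^sub>j (1 - P) f\<^sub>j)\<close>, by the closed form used in the scheme;
  \<open>P\<close> is the projection onto the kernel of \<open>A\<close>.
\<close>

definition exp_lin ::
  "nat \<Rightarrow> nat \<Rightarrow> real \<Rightarrow> nat \<Rightarrow> real \<Rightarrow> real mat \<Rightarrow> real \<Rightarrow> state \<Rightarrow> state" where
  "exp_lin k Nx L0 Nv vmax P t U =
     (let A = dg_mat k Nx L0; n = dg_dim k Nx;
          e = (\<lambda>j. mat_exp ((vel Nv vmax j * t) \<cdot>\<^sub>m A))
      in ((\<lambda>j\<in>{1..Nv}. e j *\<^sub>v fst U j),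
          snd U + vel_step Nv vmax \<cdot>\<^sub>v
            vsum n (\<lambda>j. minv (A + P) *\<^sub>v ((1\<^sub>m n - e j) *\<^sub>v fst U j)) {1..Nv}))"

definition discrete_poisson ::
  "nat \<Rightarrow> nat \<Rightarrow> real \<Rightarrow> nat \<Rightarrow> real \<Rightarrow> real mat \<Rightarrow> state \<Rightarrow> bool" where
  "discrete_poisson k Nx L0 Nv vmax P U \<longleftrightarrow>
     (dg_mat k Nx L0 + P) *\<^sub>v snd U =
       - vsum (dg_dim k Nx)
           (\<lambda>j. vel_step Nv vmax \<cdot>\<^sub>v ((1\<^sub>m (dg_dim k Nx) - P) *\<^sub>v fst U j)) {1..Nv}"


section \<open>Lawson schemes\<close>

definition lawson_euler_step ::
  "nat \<Rightarrow> nat \<Rightarrow> real \<Rightarrow> nat \<Rightarrow> real \<Rightarrow> (nat \<Rightarrow> nat \<Rightarrow> real) \<Rightarrow> real mat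
    \<Rightarrow> real \<Rightarrow> state \<Rightarrow> state \<Rightarrow> bool" where
  "lawson_euler_step k Nx L0 Nv vmax d P dt U U' \<longleftrightarrow>
     U' = state_add Nv (exp_lin k Nx L0 Nv vmax P dt U)
       (state_scale Nv dt (exp_lin k Nx L0 Nv vmax P dt (nonlin k Nx L0 Nv d U)))"

text \<open>The stages of the explicit Runge--Kutta method are \<open>V 1, \<dots>, V s\<close>.\<close>

definition lawson_rk_step ::
  "nat \<Rightarrow> nat \<Rightarrow> real \<Rightarrow> nat \<Rightarrow> real \<Rightarrow> (nat \<Rightarrow> nat \<Rightarrow> real) \<Rightarrow> real mat
    \<Rightarrow> nat \<Rightarrow> (nat \<Rightarrow> nat \<Rightarrow> real) \<Rightarrow> (nat \<Rightarrow> real) \<Rightarrow> (nat \<Rightarrow> real)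
    \<Rightarrow> real \<Rightarrow> state \<Rightarrow> state \<Rightarrow> bool" where
  "lawson_rk_step k Nx L0 Nv vmax d P s a b c dt U U' \<longleftrightarrow>
     (\<exists>V :: nat \<Rightarrow> state.
        (\<forall>p\<in>{1..s}. V p =
           state_add Nv (exp_lin k Nx L0 Nv vmax P (c p * dt) U)
             (state_scale Nv dt (state_sum k Nx Nv
               (\<lambda>q. state_scale Nv (a p q)
                      (exp_lin k Nx L0 Nv vmax P ((c p - c q) * dt) (nonlin k Nx L0 Nv d (V q))))
               {1..<p}))) \<and>
        U' =
           state_add Nv (exp_lin k Nx L0 Nv vmax P dt U)
             (state_scale Nv dt (state_sum k Nx Nv
               (\<lambda>p. state_scale Nv (b p)
                      (exp_lin k Nx L0 Nv vmax P ((1 - c p) * dt) (nonlin k Nx L0 Nv d (V p))))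
               {1..s})))"

end

(*
  The residual of the discrete Poisson equation, (A + P) E + dv * sum_j (1 - P) f_j, is linear
  in the state (f, E). The nonlinear term only changes f, and by conservativity of the velocity
  difference its velocity sum vanishes, so its residual is zero. The flow exp(t L) leaves the
  residual unchanged: (A + P) turns the increment of E into dv * sum_j (1 - exp(v_j t A)) f_j,
  and P exp(v_j t A) = P. Every stage of a Lawson method therefore preserves zero residual.
  Both P A = 0 and the invertibility of A + P hold because A is skew-adjoint for the L2 inner
  product of the piecewise polynomials and P is the orthogonal projection for that product.
*)
theory Submission
  imports Defs "Jordan_Normal_Form.Determinant"
begin

section \<open>Inverses and exponentials of real matrices\<close>

section \<open>Matrices and vectors\<close>

text \<open>\<open>minv\<close> applies \<open>the\<close> to an option, so it carries no
  information until \<open>mat_inverse\<close> is known to succeed. A trivial kernel gives a nonzero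
  determinant, hence a unit of the matrix ring. It is used for the mass matrix and for A +
  P.\<close>

lemma minv_inverse:
  assumes B: "B \<in> carrier_mat n n"
    and ker: "\<And>x. x \<in> carrier_vec n \<Longrightarrow> B *\<^sub>v x = 0\<^sub>v n \<Longrightarrow> x = 0\<^sub>v n"
  shows "minv B \<in> carrier_mat n n" and "B * minv B = 1\<^sub>m n"
proof -
  have "Determinant.det B \<noteq> 0"
    using det_0_iff_vec_prod_zero_field[OF B] ker by blast
  then have "mat_inverse B \<noteq> None"
    using mat_inverse(1)[OF B, of undefined] det_non_zero_imp_unit[OF B, of undefined] by blast
  then obtain C where "mat_inverse B = Some C" by blast
  then show "minv B \<in> carrier_mat n n" "B * minv B = 1\<^sub>m n"
    using mat_inverse(2)[OF B] by (auto simp: minv_def)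
qed

text \<open>An entry of the next power is a sum of \<open>n\<close> products, so each factor
  contributes at most \<open>n * C\<close>. This crude geometric bound is enough for comparison with
  the exponential series.\<close>

lemma abs_pow_mat_le:
  fixes B :: "real mat"
  assumes B: "B \<in> carrier_mat n n"
    and C: "\<And>r c. r < n \<Longrightarrow> c < n \<Longrightarrow> \<bar>B $$ (r, c)\<bar> \<le> C" and "0 \<le> C"
    and "r < n" "c < n"
  shows "\<bar>(B ^\<^sub>m p) $$ (r, c)\<bar> \<le> (real n * C) ^ p"
  using \<open>c < n\<close>
proof (induction p arbitrary: c)
  case 0
  then show ?case using B \<open>r < n\<close> by simp
next
  case (Suc p)
  have "(B ^\<^sub>m Suc p) $$ (r, c) = (\<Sum>i<n. (B ^\<^sub>m p) $$ (r, i) * B $$ (i, c))"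
    using B pow_carrier_mat[OF B, of p] \<open>r < n\<close> Suc.prems
    by (simp add: scalar_prod_def lessThan_atLeast0 del: pow_carrier_mat)
  also have "\<bar>\<dots>\<bar> \<le> (\<Sum>i<n. (real n * C) ^ p * C)"
    using Suc C \<open>0 \<le> C\<close>
    by (intro order.trans[OF sum_abs] sum_mono) (auto simp: abs_mult intro!: mult_mono)
  finally show ?case by (simp add: mult_ac)
qed

text \<open>The scalar exponential series at \<open>n * C\<close> dominates each entry. Only with
  summability does \<open>suminf\<close> in \<open>mat_exp\<close> denote a true limit that commutes
  with finite sums.\<close>

lemma summable_mat_exp:
  fixes B :: "real mat"
  assumes B: "B \<in> carrier_mat n n" and "r < n" "c < n"
  shows "summable (\<lambda>p. (B ^\<^sub>m p) $$ (r, c) / fact p)"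
proof -
  \<comment> \<open>Any common bound of the entries would serve; the sum of all absolute values
    avoids choosing a maximum.\<close>
  define C where "C = (\<Sum>i<n. \<Sum>j<n. \<bar>B $$ (i, j)\<bar>)"
  have "\<bar>B $$ (i, j)\<bar> \<le> C" if "i < n" "j < n" for i j
  proof -
    have "\<bar>B $$ (i, j)\<bar> \<le> (\<Sum>j<n. \<bar>B $$ (i, j)\<bar>)"
      using that by (intro member_le_sum) auto
    also have "\<dots> \<le> C" unfolding C_def
      using that by (intro member_le_sum sum_nonneg) auto
    finally show ?thesis .
  qed
  moreover have "0 \<le> C" by (simp add: C_def sum_nonneg)
  ultimately have "\<bar>(B ^\<^sub>m p) $$ (r, c)\<bar> \<le> (real n * C) ^ p" for p
    using abs_pow_mat_le[OF B] assms by blast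
  then have "norm ((B ^\<^sub>m p) $$ (r, c) / fact p) \<le> inverse (fact p) * (real n * C) ^ p" for p
    by (simp add: field_simps)
  then show ?thesis
    using summable_exp[of "real n * C"] by (rule summable_comparison_test'[rotated])
qed

lemma mat_exp_carrier: "B \<in> carrier_mat n n \<Longrightarrow> mat_exp B \<in> carrier_mat n n"
  by (auto simp: mat_exp_def)

text \<open>Multiplication by \<open>P\<close> kills every positive power of \<open>B\<close>, so
  only the constant term of the exponential series survives. With \<open>B\<close> a multiple of the
  DG matrix, it shows that the transport flow keeps the kernel component of a vector.\<close>

lemma mult_mat_exp_annihilated:
  fixes P B :: "real mat"
  assumes P: "P \<in> carrier_mat m n" and B: "B \<in> carrier_mat n n"
    and PB: "P * B = 0\<^sub>m m n"
  shows "P * mat_exp B = P"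
proof (rule eq_matI)
  fix r c assume "r < dim_row P" "c < dim_col P"
  then have rc: "r < m" "c < n" using P by auto
  have PBp: "P * B ^\<^sub>m p = (if p = 0 then P else 0\<^sub>m m n)" for p
  proof (induction p)
    case (Suc p)
    have "P * B ^\<^sub>m Suc p = (P * B ^\<^sub>m p) * B"
      using assoc_mult_mat[OF P pow_carrier_mat[OF B] B, of p] by simp
    then show ?case using Suc PB B by (cases p) auto
  qed (use P B in auto)
  have "(P * mat_exp B) $$ (r, c) = (\<Sum>i<n. P $$ (r, i) * (\<Sum>p. (B ^\<^sub>m p) $$ (i, c) / fact p))"
    using P B rc by (simp add: mat_exp_def scalar_prod_def lessThan_atLeast0)
  also have "\<dots> = (\<Sum>i<n. \<Sum>p. P $$ (r, i) * ((B ^\<^sub>m p) $$ (i, c) / fact p))"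
    using summable_mat_exp[OF B _ rc(2)] by (intro sum.cong suminf_mult[symmetric]) auto
  \<comment> \<open>Each entry of the series is summable, so the series may be exchanged with the
    finite sum over the row.\<close>
  also have "\<dots> = (\<Sum>p. \<Sum>i<n. P $$ (r, i) * ((B ^\<^sub>m p) $$ (i, c) / fact p))"
    using summable_mat_exp[OF B _ rc(2)] by (intro suminf_sum[symmetric] summable_mult) auto
  also have "\<dots> = (\<Sum>p. (P * B ^\<^sub>m p) $$ (r, c) / fact p)"
    using P rc B carrier_matD[OF pow_carrier_mat[OF B]]
    by (intro suminf_cong)
      (simp add: scalar_prod_def lessThan_atLeast0 sum_divide_distrib)
  also have "\<dots> = (\<Sum>p. if p = 0 then P $$ (r, c) else 0)"
    by (intro suminf_cong) (use rc in \<open>auto simp: PBp\<close>)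
  also have "\<dots> = P $$ (r, c)"
    using suminf_finite[of "{0::nat}" "\<lambda>p. if p = 0 then P $$ (r, c) else 0"] by simp
  finally show "(P * mat_exp B) $$ (r, c) = P $$ (r, c)" .
qed (use P B in \<open>auto simp: mat_exp_def\<close>)

section \<open>Vector identities and finite sums of vectors\<close>

lemma mult_mat_zero_vec:
  fixes B :: "real mat"
  shows "B \<in> carrier_mat m n \<Longrightarrow> B *\<^sub>v 0\<^sub>v n = 0\<^sub>v m"
  by (rule eq_vecI) auto

lemma smult_zero_vec_right [simp]:
  fixes a :: real
  shows "a \<cdot>\<^sub>v 0\<^sub>v n = 0\<^sub>v n"
  by (rule eq_vecI) auto

lemma minus_add_cancel_vec:
  fixes u v :: "real vec"
  shows "u \<in> carrier_vec n \<Longrightarrow> v \<in> carrier_vec n \<Longrightarrow> u - v + v = u"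
  by (rule eq_vecI) auto

lemma minus_add_minus_vec:
  fixes u v w :: "real vec"
  assumes "u \<in> carrier_vec n" "v \<in> carrier_vec n" "w \<in> carrier_vec n"
  shows "u - v + (v - w) = u - w"
  by (rule eq_vecI) (use assms in auto)

lemma vsum_carrier [simp]: "vsum n w S \<in> carrier_vec n"
  and dim_vsum [simp]: "dim_vec (vsum n w S) = n"
  and index_vsum [simp]: "r < n \<Longrightarrow> vsum n w S $ r = (\<Sum>j\<in>S. w j $ r)"
  by (auto simp: vsum_def)

lemma vsum_add:
  assumes "\<And>j. j \<in> S \<Longrightarrow> w j \<in> carrier_vec n" "\<And>j. j \<in> S \<Longrightarrow> z j \<in> carrier_vec n"
  shows "vsum n (\<lambda>j. w j + z j) S = vsum n w S + vsum n z S"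
proof (rule eq_vecI)
  fix r assume "r < dim_vec (vsum n w S + vsum n z S)"
  then have r: "r < n" by simp
  have "vsum n (\<lambda>j. w j + z j) S $ r = (\<Sum>j\<in>S. w j $ r + z j $ r)"
    unfolding index_vsum[OF r]
    by (rule sum.cong) (use r carrier_vecD[OF assms(2)] in simp_all)
  then show "vsum n (\<lambda>j. w j + z j) S $ r = (vsum n w S + vsum n z S) $ r"
    using r by (simp add: sum.distrib)
qed auto

lemma vsum_smult:
  assumes "\<And>j. j \<in> S \<Longrightarrow> w j \<in> carrier_vec n"
  shows "vsum n (\<lambda>j. t \<cdot>\<^sub>v w j) S = t \<cdot>\<^sub>v vsum n w S"
proof (rule eq_vecI)
  fix r assume "r < dim_vec (t \<cdot>\<^sub>v vsum n w S)"
  then have r: "r < n" by simp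
  have "vsum n (\<lambda>j. t \<cdot>\<^sub>v w j) S $ r = (\<Sum>j\<in>S. t * w j $ r)"
    unfolding index_vsum[OF r]
    by (rule sum.cong) (use r carrier_vecD[OF assms] in simp_all)
  then show "vsum n (\<lambda>j. t \<cdot>\<^sub>v w j) S $ r = (t \<cdot>\<^sub>v vsum n w S) $ r"
    using r by (simp add: sum_distrib_left)
qed auto

lemma vsum_cong: "(\<And>j. j \<in> S \<Longrightarrow> w j = z j) \<Longrightarrow> vsum n w S = vsum n z S"
  by (simp add: vsum_def)

lemma vsum_zero: "vsum n (\<lambda>j. 0\<^sub>v n) S = 0\<^sub>v n"
  by (rule eq_vecI) auto

lemma mult_mat_vsum:
  assumes B: "B \<in> carrier_mat m n" and w: "\<And>j. j \<in> S \<Longrightarrow> w j \<in> carrier_vec n"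
  shows "B *\<^sub>v vsum n w S = vsum m (\<lambda>j. B *\<^sub>v w j) S"
proof (rule eq_vecI)
  fix r assume "r < dim_vec (vsum m (\<lambda>j. B *\<^sub>v w j) S)"
  then have r: "r < m" by simp
  have "(B *\<^sub>v vsum n w S) $ r = (\<Sum>i<n. \<Sum>j\<in>S. B $$ (r, i) * w j $ i)"
    using B r by (simp add: scalar_prod_def lessThan_atLeast0 sum_distrib_left)
  also have "\<dots> = (\<Sum>j\<in>S. \<Sum>i<n. B $$ (r, i) * w j $ i)" by (rule sum.swap)
  also have "\<dots> = vsum m (\<lambda>j. B *\<^sub>v w j) S $ r"
    using B r carrier_vecD[OF w] by (simp add: scalar_prod_def lessThan_atLeast0)
  finally show "(B *\<^sub>v vsum n w S) $ r = vsum m (\<lambda>j. B *\<^sub>v w j) S $ r" .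
qed (use B in auto)

section \<open>Splitting coefficient vectors into cells\<close>

section \<open>The discontinuous Galerkin matrix\<close>

text \<open>Cutting out the block of one cell lets the small matrices act on it. The length is
  \<open>Suc k\<close>, the form to which the simplifier brings \<open>k + 1\<close>.\<close>

definition cell_coeffs :: "nat \<Rightarrow> real vec \<Rightarrow> nat \<Rightarrow> real vec" where
  "cell_coeffs k u i = vec (Suc k) (\<lambda>m. u $ (i * (k + 1) + m))"

lemma cell_coeffs_carrier [simp]: "cell_coeffs k u i \<in> carrier_vec (Suc k)"
  and dim_cell_coeffs [simp]: "dim_vec (cell_coeffs k u i) = Suc k"
  and index_cell_coeffs [simp]: "m < Suc k \<Longrightarrow> cell_coeffs k u i $ m = u $ (i * (k + 1) + m)"
  by (simp_all add: cell_coeffs_def)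

lemma dg_index_less:
  assumes "i < Nx" "m < Suc k"
  shows "i * (k + 1) + m < dg_dim k Nx"
proof -
  have "i * (k + 1) + m < (i + 1) * (k + 1)" using assms by simp
  also have "\<dots> \<le> Nx * (k + 1)" using assms by (intro mult_le_mono1) simp
  finally show ?thesis by (simp add: dg_dim_def mult.commute)
qed

lemma dg_vec_eqI:
  assumes u: "u \<in> carrier_vec (dg_dim k Nx)" and w: "w \<in> carrier_vec (dg_dim k Nx)"
    and eq: "\<And>i. i < Nx \<Longrightarrow> cell_coeffs k u i = cell_coeffs k w i"
  shows "u = w"
proof (rule eq_vecI)
  fix r assume "r < dim_vec w"
  then have r: "r < (k + 1) * Nx" using w by (simp add: dg_dim_def)
  define i m where "i = r div (k + 1)" and "m = r mod (k + 1)"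
  have "i < Nx" using r by (simp add: i_def less_mult_imp_div_less mult.commute)
  moreover have "m < Suc k" and "r = i * (k + 1) + m"
    unfolding i_def m_def using div_mult_mod_eq[of r "k + 1"] by simp_all
  ultimately show "u $ r = w $ r" by (metis eq index_cell_coeffs)
qed (use u w in auto)

text \<open>The index range is a concatenation of \<open>Nx\<close> blocks of length
  \<open>k + 1\<close>. This turns a row of the DG matrix times a vector into a double sum over
  cells and degrees.\<close>

lemma sum_dg_dim:
  fixes g :: "nat \<Rightarrow> real"
  shows "(\<Sum>r<dg_dim k Nx. g r) = (\<Sum>i<Nx. \<Sum>m<Suc k. g (i * (k + 1) + m))"
proof -
  have "sum g {i * (k + 1)..<i * (k + 1) + (k + 1)} = (\<Sum>m<Suc k. g (i * (k + 1) + m))" for i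
    using sum.shift_bounds_nat_ivl[of g 0 "i * (k + 1)" "k + 1"]
    by (simp add: lessThan_atLeast0 add_ac)
  then show ?thesis
    using sum.nat_group[of g "k + 1" Nx] by (simp add: dg_dim_def mult.commute)
qed

section \<open>The local matrices and their symmetries\<close>

lemma mat_carriers [simp]:
  "mass_mat k \<in> carrier_mat (Suc k) (Suc k)" "D1_mat k \<in> carrier_mat (Suc k) (Suc k)"
  "D2_mat k \<in> carrier_mat (Suc k) (Suc k)" "D3_mat k \<in> carrier_mat (Suc k) (Suc k)"
  "dg_mat k Nx L0 \<in> carrier_mat (dg_dim k Nx) (dg_dim k Nx)"
  by (simp_all add: mass_mat_def D1_mat_def D2_mat_def D3_mat_def dg_mat_def)

lemmas mat_mult_carriers [simp] = mat_carriers(1-4)[THEN mult_mat_vec_carrier]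

lemma scalar_prod_mult_mat_vec:
  fixes x y :: "real vec"
  assumes "D \<in> carrier_mat n n" "x \<in> carrier_vec n" "y \<in> carrier_vec n"
  shows "x \<bullet> (D *\<^sub>v y) = (\<Sum>l<n. \<Sum>m<n. x $ l * D $$ (l, m) * y $ m)"
  using assms
  by (simp add: scalar_prod_def lessThan_atLeast0 sum_distrib_left mult.assoc)

text \<open>The hypothesis \<open>anti\<close> says entrywise that \<open>D'\<close> is minus the
  transpose of \<open>D\<close>. Two separate matrices are allowed so that one lemma covers both
  \<open>D1_mat\<close>, paired with itself, and \<open>D2_mat\<close>, paired with
  \<open>D3_mat\<close>.\<close>

lemma scalar_prod_transpose_neg:
  fixes x y :: "real vec"
  assumes D: "D \<in> carrier_mat n n" and D': "D' \<in> carrier_mat n n"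
    and xy: "x \<in> carrier_vec n" "y \<in> carrier_vec n"
    and anti: "\<And>l m. l < n \<Longrightarrow> m < n \<Longrightarrow> D' $$ (m, l) = - D $$ (l, m)"
  shows "x \<bullet> (D *\<^sub>v y) = - (y \<bullet> (D' *\<^sub>v x))"
proof -
  have "y \<bullet> (D' *\<^sub>v x) = (\<Sum>m<n. \<Sum>l<n. y $ m * D' $$ (m, l) * x $ l)"
    using scalar_prod_mult_mat_vec[OF D' xy(2,1)] .
  also have "\<dots> = (\<Sum>l<n. \<Sum>m<n. y $ m * D' $$ (m, l) * x $ l)" by (rule sum.swap)
  also have "\<dots> = (\<Sum>l<n. \<Sum>m<n. - (x $ l * D $$ (l, m) * y $ m))"
    by (intro sum.cong) (simp_all add: anti)
  also have "\<dots> = - (x \<bullet> (D *\<^sub>v y))"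
    by (simp add: scalar_prod_mult_mat_vec[OF D xy] sum_negf)
  finally show ?thesis by simp
qed

text \<open>The fractions l/(l+m) and m/(l+m) add up to 1, so subtracting 1/2 makes them opposite;
  the other factors are symmetric. Behind this is integration by parts in a cell: the entry is the
  integral of the derivative of one basis function times the other, minus half the boundary
  term.\<close>

lemma D1_mat_transpose:
  assumes lm: "l < Suc k" "m < Suc k"
  shows "D1_mat k $$ (m, l) = - D1_mat k $$ (l, m)"
\<comment> \<open>The corner entry is set to 0 by definition and must be split off, since the
  fractions would have denominator 0.\<close>
proof (cases "l = 0 \<and> m = 0")
  case False
  define s where "s = l + m"
  have s: "0 < s" "m + l = s" "real s = real l + real m" using False by (auto simp: s_def)
  have "real m / real s - 1/2 = - (real l / real s - 1/2)"
    using s(1,3) by (simp add: field_simps)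
  moreover have "D1_mat k $$ (l, m) = (1/2) ^ s * (real l / real s - 1/2) * (1 - (-1) ^ s)"
    "D1_mat k $$ (m, l) = (1/2) ^ s * (real m / real s - 1/2) * (1 - (-1) ^ s)"
    unfolding D1_mat_def using lm False by (simp_all only: index_mat prod.case s(2) s_def[symmetric]) auto
  ultimately show ?thesis by (metis mult_minus_left mult_minus_right)
qed (use lm in \<open>simp add: D1_mat_def\<close>)

text \<open>Both matrices describe the coupling across one interface, a trace at 1/2 in the left
  cell times a trace at -1/2 in the right cell, seen from the two sides with opposite outward
  normals.\<close>

lemma D3_mat_transpose:
  assumes "l < Suc k" "m < Suc k"
  shows "D3_mat k $$ (m, l) = - D2_mat k $$ (l, m)"
proof -
  have "m + l + 1 = l + m + 1" by simp
  then show ?thesis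
    using assms unfolding D2_mat_def D3_mat_def by (simp only: index_mat prod.case power_add) simp
qed

section \<open>The mass matrix as Gram matrix of the inner product\<close>

lemma cell_size_pos: "0 < L0 \<Longrightarrow> 1 \<le> Nx \<Longrightarrow> 0 < cell_size Nx L0"
  by (simp add: cell_size_def)

lemma has_integral_basis_fun:
  assumes dx: "0 < cell_size Nx L0" and lm: "l < Suc k" "m < Suc k"
  shows "((\<lambda>x. basis_fun Nx L0 i l x * basis_fun Nx L0 i m x)
    has_integral cell_size Nx L0 * mass_mat k $$ (l, m)) (cell Nx L0 i)"
proof -
  define h where "h = cell_size Nx L0"
  define n where "n = l + m"
  \<comment> \<open>An antiderivative; the leading factor \<open>h\<close> compensates the inner
    derivative \<open>1 / h\<close>.\<close>
  define F where "F x = h * ((x - (real i + 1/2) * h) / h) ^ Suc n / real (Suc n)" for x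
  have h: "h > 0" using dx by (simp add: h_def)
  have "((\<lambda>x. ((x - (real i + 1/2) * h) / h) ^ n) has_integral
      F ((real i + 1) * h) - F (real i * h)) {real i * h..(real i + 1) * h}"
  proof (rule fundamental_theorem_of_calculus)
    show "real i * h \<le> (real i + 1) * h" using h by simp
  next
    fix x
    have "((\<lambda>x. (x - (real i + 1/2) * h) / h) has_real_derivative 1 / h) (at x)"
      using h by (auto intro!: derivative_eq_intros)
    from DERIV_cdivide[OF DERIV_cmult[OF DERIV_power_Suc[OF this, of n], of h], of "real (Suc n)"]
    have "(F has_real_derivative ((x - (real i + 1/2) * h) / h) ^ n) (at x)"
      unfolding F_def using h by (simp del: power_Suc)
    then show "(F has_vector_derivative ((x - (real i + 1/2) * h) / h) ^ n)
        (at x within {real i * h..(real i + 1) * h})"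
      by (simp add: has_real_derivative_iff_has_vector_derivative has_vector_derivative_at_within)
  qed
  moreover have "F ((real i + 1) * h) - F (real i * h) = h * mass_mat k $$ (l, m)"
  proof -
    \<comment> \<open>The local coordinate at the two ends of the cell. The left value is written as
      a product so that its power splits into a sign and a power of 1/2.\<close>
    have "((real i + 1) * h - (real i + 1/2) * h) / h = 1/2"
      and "(real i * h - (real i + 1/2) * h) / h = (-1) * (1/2)"
      using h by (simp_all add: field_simps)
    then have "F ((real i + 1) * h) - F (real i * h)
        = h * ((1/2) ^ Suc n - (-1) ^ Suc n * (1/2) ^ Suc n) / real (Suc n)"
      unfolding F_def by (simp only: power_mult_distrib diff_divide_distrib right_diff_distrib)
    also have "\<dots> = h * mass_mat k $$ (l, m)"
    proof -
      have "mass_mat k $$ (l, m) = (1/2) ^ Suc n / real (Suc n) * (1 - (-1) ^ Suc n)"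
        using lm by (simp only: mass_mat_def index_mat prod.case n_def Suc_eq_plus1)
      moreover have "h * (X - Y * X) / Z = h * (X / Z * (1 - Y))" for X Y Z :: real
        by (simp add: algebra_simps diff_divide_distrib)
      ultimately show ?thesis by (simp only:)
    qed
    finally show ?thesis .
  qed
  ultimately show ?thesis
    by (simp add: basis_fun_def cell_def h_def n_def power_add)
qed

lemma has_integral_dg_fun_mult:
  assumes "0 < cell_size Nx L0"
  shows "((\<lambda>x. dg_fun k Nx L0 u i x * dg_fun k Nx L0 w i x) has_integral
    cell_size Nx L0 * (cell_coeffs k u i \<bullet> (mass_mat k *\<^sub>v cell_coeffs k w i))) (cell Nx L0 i)"
proof -
  let ?b = "basis_fun Nx L0 i" and ?h = "cell_size Nx L0"
  let ?x = "\<lambda>m. cell_coeffs k u i $ m" and ?y = "\<lambda>m. cell_coeffs k w i $ m"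
  have fun_eq: "dg_fun k Nx L0 v i x = (\<Sum>m<Suc k. cell_coeffs k v i $ m * ?b m x)" for v x
    unfolding dg_fun_def by (intro sum.cong) auto
  have "((\<lambda>x. \<Sum>l<Suc k. \<Sum>m<Suc k. ?x l * ?y m * (?b l x * ?b m x)) has_integral
      (\<Sum>l<Suc k. \<Sum>m<Suc k. ?x l * ?y m * (?h * mass_mat k $$ (l, m)))) (cell Nx L0 i)"
    by (intro has_integral_sum has_integral_mult_right has_integral_basis_fun assms) auto
  moreover have "(\<Sum>l<Suc k. \<Sum>m<Suc k. ?x l * ?y m * (?b l x * ?b m x))
      = dg_fun k Nx L0 u i x * dg_fun k Nx L0 w i x" for x
    unfolding fun_eq sum_product by (intro sum.cong) (simp_all add: mult_ac)
  moreover have "(\<Sum>l<Suc k. \<Sum>m<Suc k. ?x l * ?y m * (?h * mass_mat k $$ (l, m)))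
      = ?h * (cell_coeffs k u i \<bullet> (mass_mat k *\<^sub>v cell_coeffs k w i))"
    unfolding scalar_prod_mult_mat_vec[OF mat_carriers(1) cell_coeffs_carrier cell_coeffs_carrier]
      sum_distrib_left
    by (intro sum.cong) (simp_all add: mult_ac)
  ultimately show ?thesis by simp
qed

lemma dg_inner_eq:
  assumes "0 < cell_size Nx L0"
  shows "dg_inner k Nx L0 u w =
    (\<Sum>i<Nx. cell_size Nx L0 * (cell_coeffs k u i \<bullet> (mass_mat k *\<^sub>v cell_coeffs k w i)))"
  unfolding dg_inner_def
  by (intro sum.cong integral_unique has_integral_dg_fun_mult assms) simp

lemma dg_inner_commute: "dg_inner k Nx L0 u w = dg_inner k Nx L0 w u"
  by (simp add: dg_inner_def mult.commute)

lemma dg_inner_diff_left: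
  assumes dx: "0 < cell_size Nx L0"
    and "u \<in> carrier_vec (dg_dim k Nx)" "w \<in> carrier_vec (dg_dim k Nx)"
  shows "dg_inner k Nx L0 (u - w) z = dg_inner k Nx L0 u z - dg_inner k Nx L0 w z"
proof -
  have "cell_coeffs k (u - w) i = cell_coeffs k u i - cell_coeffs k w i" if "i < Nx" for i
    by (rule eq_vecI) (use assms dg_index_less[OF that] in auto)
  then show ?thesis
    unfolding dg_inner_eq[OF dx] sum_subtractf[symmetric] right_diff_distrib[symmetric]
    by (intro sum.cong refl)
      (simp add: minus_scalar_prod_distrib[where n = "Suc k"])
qed

text \<open>A vanishing sum of nonnegative cell integrals makes each of them vanish. A continuous
  square with zero integral is zero on the cell, and a polynomial with infinitely many zeros has
  zero coefficients.\<close>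

lemma dg_inner_self_eq_0:
  assumes dx: "0 < cell_size Nx L0" and u: "u \<in> carrier_vec (dg_dim k Nx)"
    and zero: "dg_inner k Nx L0 u u = 0"
  shows "u = 0\<^sub>v (dg_dim k Nx)"
proof (rule dg_vec_eqI[OF u])
  fix i assume i: "i < Nx"
  let ?h = "cell_size Nx L0"
  let ?g = "\<lambda>x. dg_fun k Nx L0 u i x * dg_fun k Nx L0 u i x"
  have "\<And>i. 0 \<le> integral (cell Nx L0 i) (\<lambda>x. dg_fun k Nx L0 u i x * dg_fun k Nx L0 u i x)"
    by (intro integral_nonneg has_integral_integrable[OF has_integral_dg_fun_mult[OF dx]]) simp
  then have "integral (cell Nx L0 i) ?g = 0"
    using zero i unfolding dg_inner_def by (subst (asm) sum_nonneg_eq_0_iff) auto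
  then have int0: "(?g has_integral 0) (cbox (real i * ?h) ((real i + 1) * ?h))"
    using has_integral_integral[THEN iffD1, OF has_integral_integrable[OF has_integral_dg_fun_mult[OF dx]],
        of k u i u]
    by (simp add: cell_def)
  have vanish: "dg_fun k Nx L0 u i x = 0" if "x \<in> cell Nx L0 i" for x
  proof -
    have "?g x = 0"
    proof (rule has_integral_0_cbox_imp_0[OF _ _ int0])
      show "continuous_on (cbox (real i * ?h) ((real i + 1) * ?h)) ?g"
        unfolding dg_fun_def basis_fun_def using dx by (intro continuous_intros) auto
      show "box (real i * ?h) ((real i + 1) * ?h) \<noteq> {}" using dx by simp
    qed (use that in \<open>auto simp: cell_def\<close>)
    then show ?thesis by simp
  qed
  \<comment> \<open>Here \<open>y\<close> is the local coordinate on the right half of the cell,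
    which already provides infinitely many zeros.\<close>
  have "(\<Sum>m\<le>k. u $ (i * (k + 1) + m) * y ^ m) = 0" if y: "y \<in> {0..1/2}" for y
  proof -
    have "(real i + 1/2) * ?h + ?h * y \<in> cell Nx L0 i"
    proof -
      have "0 \<le> ?h * y" "?h * y \<le> ?h * (1/2)"
        using dx y by (simp_all add: mult_left_mono del: times_divide_eq_right)
      then show ?thesis using dx
        unfolding cell_def atLeastAtMost_iff distrib_right by (intro conjI; linarith)
    qed
    from vanish[OF this] show ?thesis
      using dx by (simp add: dg_fun_def basis_fun_def)
  qed
  then have "{0..1/2} \<subseteq> {y::real. (\<Sum>m\<le>k. u $ (i * (k + 1) + m) * y ^ m) = 0}" by auto
  moreover have "infinite {0..1/2::real}" by (simp add: infinite_Icc)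
  ultimately have "infinite {y::real. (\<Sum>m\<le>k. u $ (i * (k + 1) + m) * y ^ m) = 0}"
    using finite_subset by blast
  then have "u $ (i * (k + 1) + m) = 0" if "m \<le> k" for m
    using polyfun_finite_roots[of "\<lambda>m. u $ (i * (k + 1) + m)" k] that by blast
  then show "cell_coeffs k u i = cell_coeffs k (0\<^sub>v (dg_dim k Nx)) i"
    using dg_index_less[OF i] by (intro eq_vecI) auto
qed simp

text \<open>A single cell of unit length: there the mass matrix is the Gram matrix of \<open>dg_inner\<close>.\<close>

lemma mass_mat_inverse:
  "minv (mass_mat k) \<in> carrier_mat (Suc k) (Suc k)"
  "mass_mat k * minv (mass_mat k) = 1\<^sub>m (Suc k)"
proof -
  have "x = 0\<^sub>v (Suc k)" if x: "x \<in> carrier_vec (Suc k)" "mass_mat k *\<^sub>v x = 0\<^sub>v (Suc k)" for x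
  proof -
    have "cell_coeffs k x 0 = x" by (rule eq_vecI) (use x in auto)
    then have "dg_inner k 1 1 x x = 0"
      using x by (simp add: dg_inner_eq cell_size_def)
    then show ?thesis
      using dg_inner_self_eq_0[of 1 1 x k] x by (simp add: cell_size_def dg_dim_def)
  qed
  then show "minv (mass_mat k) \<in> carrier_mat (Suc k) (Suc k)"
    "mass_mat k * minv (mass_mat k) = 1\<^sub>m (Suc k)"
    using minv_inverse[OF mat_carriers(1)] by blast+
qed

section \<open>The DG matrix cell by cell, its skew-adjointness and its kernel\<close>

definition dg_flux :: "nat \<Rightarrow> nat \<Rightarrow> real vec \<Rightarrow> nat \<Rightarrow> real vec" where
  "dg_flux k Nx u i = D1_mat k *\<^sub>v cell_coeffs k u i
     + D2_mat k *\<^sub>v cell_coeffs k u ((i + 1) mod Nx)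
     + D3_mat k *\<^sub>v cell_coeffs k u ((i + Nx - 1) mod Nx)"

lemma dg_flux_carrier [simp]: "dg_flux k Nx u i \<in> carrier_vec (Suc k)"
  by (simp add: dg_flux_def)

text \<open>Recovers the block formula from the entrywise definition of \<open>dg_mat\<close>. The
  inverse mass matrix stays in front of \<open>dg_flux\<close> so that the mass matrix of the inner
  product can cancel it.\<close>

lemma cell_coeffs_dg_mat_mult:
  assumes i: "i < Nx" and u: "u \<in> carrier_vec (dg_dim k Nx)"
  shows "cell_coeffs k (dg_mat k Nx L0 *\<^sub>v u) i =
    (1 / cell_size Nx L0) \<cdot>\<^sub>v (minv (mass_mat k) *\<^sub>v dg_flux k Nx u i)"
proof (rule eq_vecI)
  let ?N = "minv (mass_mat k)" and ?h = "cell_size Nx L0" and ?x = "cell_coeffs k u"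
  let ?i1 = "(i + 1) mod Nx" and ?i2 = "(i + Nx - 1) mod Nx"
  note N = mass_mat_inverse(1)[of k]
  have carriers: "?N * D1_mat k \<in> carrier_mat (Suc k) (Suc k)"
    "?N * D2_mat k \<in> carrier_mat (Suc k) (Suc k)" "?N * D3_mat k \<in> carrier_mat (Suc k) (Suc k)"
    using N by (auto intro!: mult_carrier_mat[where n = "Suc k"])
  fix l assume "l < dim_vec ((1 / ?h) \<cdot>\<^sub>v (?N *\<^sub>v dg_flux k Nx u i))"
  then have l: "l < Suc k" using N by simp
  note il = dg_index_less[OF i l]
  \<comment> \<open>The indicator leaves a single cell of the double sum. The three indicators are
    treated separately, so neighbours that coincide for \<open>Nx\<close> at most 2 are counted
    correctly.\<close>
  have pick: "(\<Sum>i'<Nx. \<Sum>m<Suc k. (if i' = j then (B :: real mat) $$ (l, m) else 0) * ?x i' $ m)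
      = (B *\<^sub>v ?x j) $ l" if "j < Nx" and B: "B \<in> carrier_mat (Suc k) (Suc k)" for j B
  proof -
    have "(\<Sum>i'<Nx. \<Sum>m<Suc k. (if i' = j then B $$ (l, m) else 0) * ?x i' $ m)
        = (\<Sum>i'<Nx. if i' = j then \<Sum>m<Suc k. B $$ (l, m) * ?x j $ m else 0)"
      by (intro sum.cong) auto
    also have "\<dots> = (B *\<^sub>v ?x j) $ l"
      using that l by (simp add: scalar_prod_def lessThan_atLeast0 del: sum.op_ivl_Suc)
    finally show ?thesis .
  qed
  have "cell_coeffs k (dg_mat k Nx L0 *\<^sub>v u) i $ l
      = (\<Sum>c<dg_dim k Nx. dg_mat k Nx L0 $$ (i * (k + 1) + l, c) * u $ c)"
    using l il u carrier_matD[OF mat_carriers(5)[of k Nx L0]]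
    by (simp add: scalar_prod_def lessThan_atLeast0)
  also have "\<dots> = (\<Sum>i'<Nx. \<Sum>m<Suc k.
      dg_mat k Nx L0 $$ (i * (k + 1) + l, i' * (k + 1) + m) * u $ (i' * (k + 1) + m))"
    by (rule sum_dg_dim)
  also have "\<dots> = (\<Sum>i'<Nx. \<Sum>m<Suc k. 1 / ?h *
        ((if i' = i then (?N * D1_mat k) $$ (l, m) else 0) * ?x i' $ m
       + (if i' = ?i1 then (?N * D2_mat k) $$ (l, m) else 0) * ?x i' $ m
       + (if i' = ?i2 then (?N * D3_mat k) $$ (l, m) else 0) * ?x i' $ m))"
  proof (intro sum.cong refl)
    fix i' m assume im: "i' \<in> {..<Nx}" "m \<in> {..<Suc k}"
    have "(i * (k + 1) + l) div (k + 1) = i" "(i * (k + 1) + l) mod (k + 1) = l"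
      "(i' * (k + 1) + m) div (k + 1) = i'" "(i' * (k + 1) + m) mod (k + 1) = m"
      using l im by (simp_all del: mult_Suc_right add: div_add1_eq)
    then have "dg_mat k Nx L0 $$ (i * (k + 1) + l, i' * (k + 1) + m) = 1 / ?h *
        ((if i' = i then (?N * D1_mat k) $$ (l, m) else 0)
       + (if i' = ?i1 then (?N * D2_mat k) $$ (l, m) else 0)
       + (if i' = ?i2 then (?N * D3_mat k) $$ (l, m) else 0))"
      using il dg_index_less[of i' Nx m k] im
      unfolding dg_mat_def by (simp only: index_mat Let_def prod.case lessThan_iff)
    then show "dg_mat k Nx L0 $$ (i * (k + 1) + l, i' * (k + 1) + m) * u $ (i' * (k + 1) + m)
      = 1 / ?h *
        ((if i' = i then (?N * D1_mat k) $$ (l, m) else 0) * ?x i' $ m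
       + (if i' = ?i1 then (?N * D2_mat k) $$ (l, m) else 0) * ?x i' $ m
       + (if i' = ?i2 then (?N * D3_mat k) $$ (l, m) else 0) * ?x i' $ m)"
      using im by (simp only: index_cell_coeffs lessThan_iff distrib_left distrib_right mult.assoc)
  qed
  also have "\<dots> = 1 / ?h * (((?N * D1_mat k) *\<^sub>v ?x i) $ l
      + ((?N * D2_mat k) *\<^sub>v ?x ?i1) $ l + ((?N * D3_mat k) *\<^sub>v ?x ?i2) $ l)"
    using i by (simp only: sum_distrib_left[symmetric] sum.distrib pick[OF i carriers(1)]
        pick[OF mod_less_divisor carriers(2)] pick[OF mod_less_divisor carriers(3)])
  also have "\<dots> = ((1 / ?h) \<cdot>\<^sub>v (?N *\<^sub>v dg_flux k Nx u i)) $ l"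
  proof -
    have "?N *\<^sub>v dg_flux k Nx u i = (?N * D1_mat k) *\<^sub>v ?x i
        + (?N * D2_mat k) *\<^sub>v ?x ?i1 + (?N * D3_mat k) *\<^sub>v ?x ?i2"
      by (simp add: dg_flux_def mult_add_distrib_mat_vec[OF N]
          assoc_mult_mat_vec[OF N mat_carriers(2)] assoc_mult_mat_vec[OF N mat_carriers(3)]
          assoc_mult_mat_vec[OF N mat_carriers(4)])
    then show ?thesis using l N carriers by simp
  qed
  finally show "cell_coeffs k (dg_mat k Nx L0 *\<^sub>v u) i $ l
    = ((1 / ?h) \<cdot>\<^sub>v (?N *\<^sub>v dg_flux k Nx u i)) $ l" .
qed (use mass_mat_inverse(1)[of k] in simp)

text \<open>Moving to the next cell permutes the cells, with the move to the previous cell as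
  inverse. Adding \<open>N\<close> before subtracting 1 avoids truncated subtraction at cell
  0.\<close>

lemma sum_cyclic_shift:
  fixes g :: "nat \<Rightarrow> nat \<Rightarrow> real"
  shows "(\<Sum>i<N. g i ((i + 1) mod N)) = (\<Sum>i<N. g ((i + N - 1) mod N) i)"
proof (rule sum.reindex_bij_witness[where i = "\<lambda>i. (i + N - 1) mod N" and j = "\<lambda>i. (i + 1) mod N"])
  fix i assume i: "i \<in> {..<N}"
  show "((i + 1) mod N + N - 1) mod N = i"
    using i by (cases "i + 1 = N") auto
  show "((i + N - 1) mod N + 1) mod N = i"
    using i by (cases "i = 0") (auto simp: mod_if)
  then show "g ((((i + 1) mod N) + N - 1) mod N) ((i + 1) mod N) = g i ((i + 1) mod N)"
    using i by (cases "i + 1 = N") auto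
qed auto

text \<open>Skew-adjointness rests on \<open>D\<^sub>1\<^sup>T = - D\<^sub>1\<close> and \<open>D\<^sub>2\<^sup>T = - D\<^sub>3\<close>.\<close>

lemma dg_inner_dg_mat_skew:
  assumes dx: "0 < cell_size Nx L0"
    and u: "u \<in> carrier_vec (dg_dim k Nx)" and w: "w \<in> carrier_vec (dg_dim k Nx)"
  shows "dg_inner k Nx L0 w (dg_mat k Nx L0 *\<^sub>v u) = - dg_inner k Nx L0 u (dg_mat k Nx L0 *\<^sub>v w)"
proof -
  let ?c = "cell_coeffs k"
  let ?next = "\<lambda>i. (i + 1) mod Nx" and ?prev = "\<lambda>i. (i + Nx - 1) mod Nx"
  \<comment> \<open>The mass matrix cancels its inverse and the cell size cancels its reciprocal,
    which leaves only the three flux contributions.\<close>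
  have inner: "dg_inner k Nx L0 w (dg_mat k Nx L0 *\<^sub>v u) = (\<Sum>i<Nx. ?c w i \<bullet> (D1_mat k *\<^sub>v ?c u i))
      + (\<Sum>i<Nx. ?c w i \<bullet> (D2_mat k *\<^sub>v ?c u (?next i)))
      + (\<Sum>i<Nx. ?c w i \<bullet> (D3_mat k *\<^sub>v ?c u (?prev i)))"
    if u: "u \<in> carrier_vec (dg_dim k Nx)" for u w
  proof -
    have flux: "mass_mat k *\<^sub>v (minv (mass_mat k) *\<^sub>v dg_flux k Nx u i) = dg_flux k Nx u i" for i
      using assoc_mult_mat_vec[OF mat_carriers(1) mass_mat_inverse(1) dg_flux_carrier]
        mass_mat_inverse(2)[of k] one_mult_mat_vec[OF dg_flux_carrier] by metis
    have split: "?c w i \<bullet> dg_flux k Nx u i = ?c w i \<bullet> (D1_mat k *\<^sub>v ?c u i)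
        + ?c w i \<bullet> (D2_mat k *\<^sub>v ?c u (?next i)) + ?c w i \<bullet> (D3_mat k *\<^sub>v ?c u (?prev i))" for i
      by (simp add: dg_flux_def scalar_prod_add_distrib[where n = "Suc k"])
    have "dg_inner k Nx L0 w (dg_mat k Nx L0 *\<^sub>v u) = (\<Sum>i<Nx. ?c w i \<bullet> dg_flux k Nx u i)"
      unfolding dg_inner_eq[OF dx]
    proof (intro sum.cong refl)
      fix i assume "i \<in> {..<Nx}"
      then have "mass_mat k *\<^sub>v ?c (dg_mat k Nx L0 *\<^sub>v u) i
          = (1 / cell_size Nx L0) \<cdot>\<^sub>v dg_flux k Nx u i"
        using cell_coeffs_dg_mat_mult[OF _ u, of i] flux
          mult_mat_vec[OF mat_carriers(1) mult_mat_vec_carrier[OF mass_mat_inverse(1) dg_flux_carrier]]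
        by simp
      then show "cell_size Nx L0 * (?c w i \<bullet> (mass_mat k *\<^sub>v ?c (dg_mat k Nx L0 *\<^sub>v u) i))
          = ?c w i \<bullet> dg_flux k Nx u i"
        using dx by (simp add: scalar_prod_smult_distrib[where n = "Suc k"])
    qed
    then show ?thesis by (simp only: split sum.distrib)
  qed
  have D1: "x \<bullet> (D1_mat k *\<^sub>v y) = - (y \<bullet> (D1_mat k *\<^sub>v x))"
    if "x \<in> carrier_vec (Suc k)" "y \<in> carrier_vec (Suc k)" for x y
    by (rule scalar_prod_transpose_neg[OF mat_carriers(2,2) that D1_mat_transpose])
  have D23: "x \<bullet> (D2_mat k *\<^sub>v y) = - (y \<bullet> (D3_mat k *\<^sub>v x))"
    if "x \<in> carrier_vec (Suc k)" "y \<in> carrier_vec (Suc k)" for x y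
    by (rule scalar_prod_transpose_neg[OF mat_carriers(3,4) that D3_mat_transpose])
  have "(\<Sum>i<Nx. ?c w i \<bullet> (D2_mat k *\<^sub>v ?c u (?next i)))
      = - (\<Sum>i<Nx. ?c u i \<bullet> (D3_mat k *\<^sub>v ?c w (?prev i)))" for u w
  proof -
    have "(\<Sum>i<Nx. ?c w i \<bullet> (D2_mat k *\<^sub>v ?c u (?next i)))
        = (\<Sum>i<Nx. ?c w (?prev i) \<bullet> (D2_mat k *\<^sub>v ?c u i))"
      by (rule sum_cyclic_shift)
    also have "\<dots> = (\<Sum>i<Nx. - (?c u i \<bullet> (D3_mat k *\<^sub>v ?c w (?prev i))))"
      by (intro sum.cong refl D23 cell_coeffs_carrier)
    finally show ?thesis by (simp only: sum_negf)
  qed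
  \<comment> \<open>Both inner products contain a \<open>D2_mat\<close> sum; each becomes minus the
    \<open>D3_mat\<close> sum of the other one.\<close>
  note D2 = this[of w u] this[of u w]
  have "(\<Sum>i<Nx. ?c w i \<bullet> (D1_mat k *\<^sub>v ?c u i))
      = (\<Sum>i<Nx. - (?c u i \<bullet> (D1_mat k *\<^sub>v ?c w i)))"
    by (intro sum.cong refl D1 cell_coeffs_carrier)
  then show ?thesis
    unfolding inner[OF u] inner[OF w] D2 sum_negf by simp
qed

text \<open>By skew-adjointness the range of A is orthogonal to its kernel, so \<open>P\<close>
  kills the range. If Ax + Px = 0, applying \<open>P\<close> leaves Px = 0, hence Ax = 0; then x
  lies in the kernel, where \<open>P\<close> is the identity, so x = Px = 0.\<close>

lemma dg_projection_props:
  assumes dx: "0 < cell_size Nx L0"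
    and proj: "orthogonal_projection_onto (dg_inner k Nx L0) (dg_dim k Nx) (mat_kernel (dg_mat k Nx L0)) P"
  shows projection_carrier: "P \<in> carrier_mat (dg_dim k Nx) (dg_dim k Nx)"
    and projection_mult_dg_mat: "P * dg_mat k Nx L0 = 0\<^sub>m (dg_dim k Nx) (dg_dim k Nx)"
    and dg_mat_add_projection_inverse:
      "minv (dg_mat k Nx L0 + P) \<in> carrier_mat (dg_dim k Nx) (dg_dim k Nx)"
      "(dg_mat k Nx L0 + P) * minv (dg_mat k Nx L0 + P) = 1\<^sub>m (dg_dim k Nx)"
proof -
  let ?n = "dg_dim k Nx" and ?A = "dg_mat k Nx L0" and ?ip = "dg_inner k Nx L0"
  note A = mat_carriers(5)[of k Nx L0]
  show P: "P \<in> carrier_mat ?n ?n"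
    using proj by (simp add: orthogonal_projection_onto_def)
  note Pu = mult_mat_vec_carrier[OF P] and Au = mult_mat_vec_carrier[OF A]
  have ker: "?A *\<^sub>v (P *\<^sub>v u) = 0\<^sub>v ?n"
    and orth: "\<And>w. w \<in> carrier_vec ?n \<Longrightarrow> ?A *\<^sub>v w = 0\<^sub>v ?n \<Longrightarrow> ?ip (u - P *\<^sub>v u) w = 0"
    if "u \<in> carrier_vec ?n" for u
    using proj that mat_kernel[OF A] by (auto simp: orthogonal_projection_onto_def)
  have inner_zero: "?ip u (0\<^sub>v ?n) = 0" for u
  proof -
    have "?ip (0\<^sub>v ?n - 0\<^sub>v ?n) u = 0"
      by (subst dg_inner_diff_left[OF dx]) auto
    then show ?thesis by (simp add: dg_inner_commute)
  qed
  have PA: "P *\<^sub>v (?A *\<^sub>v u) = 0\<^sub>v ?n" if u: "u \<in> carrier_vec ?n" for u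
  proof -
    let ?w = "P *\<^sub>v (?A *\<^sub>v u)"
    have w: "?w \<in> carrier_vec ?n" "?A *\<^sub>v ?w = 0\<^sub>v ?n" using ker Pu Au u by simp_all
    \<comment> \<open>Since \<open>?w\<close> lies in the kernel, the right-hand side is zero.
      Orthogonality of the projection error to \<open>?w\<close> then identifies the left-hand side
      with the squared norm of \<open>?w\<close>.\<close>
    have "?ip (?A *\<^sub>v u) ?w = - ?ip u (?A *\<^sub>v ?w)"
      using dg_inner_dg_mat_skew[OF dx u w(1)] by (simp only: dg_inner_commute)
    then have "?ip ?w ?w = 0"
      using orth[OF Au[OF u] w] w dg_inner_diff_left[OF dx Au[OF u] w(1), of ?w] inner_zero
      by simp
    then show ?thesis using dg_inner_self_eq_0[OF dx w(1)] by simp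
  qed
  show "P * ?A = 0\<^sub>m ?n ?n"
  proof (rule eq_matI)
    fix r c assume "r < dim_row (0\<^sub>m ?n ?n :: real mat)" "c < dim_col (0\<^sub>m ?n ?n :: real mat)"
    then have rc: "r < ?n" "c < ?n" by simp_all
    have "A' *\<^sub>v unit_vec ?n c = col A' c" if "A' \<in> carrier_mat ?n ?n" for A' :: "real mat"
      by (rule eq_vecI) (use that rc in auto)
    then have "col (P * ?A) c = 0\<^sub>v ?n"
      using PA[of "unit_vec ?n c"] assoc_mult_mat_vec[OF P A, of "unit_vec ?n c"]
        mult_carrier_mat[OF P A] by simp
    then have "col (P * ?A) c $ r = 0" using rc by simp
    then show "(P * ?A) $$ (r, c) = (0\<^sub>m ?n ?n :: real mat) $$ (r, c)" using rc carrier_matD[OF P] carrier_matD[OF A] by simp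
  qed (use carrier_matD[OF P] carrier_matD[OF A] in simp_all)
  \<comment> \<open>The definition of the projection does not state that kernel vectors are fixed.
    For such \<open>u\<close> the error \<open>u - P *\<^sub>v u\<close> lies in the kernel and is
    orthogonal to it, hence to itself.\<close>
  have fixed: "P *\<^sub>v u = u" if u: "u \<in> carrier_vec ?n" "?A *\<^sub>v u = 0\<^sub>v ?n" for u
  proof -
    have "?A *\<^sub>v (u - P *\<^sub>v u) = 0\<^sub>v ?n"
      using u ker[OF u(1)] Pu by (simp add: mult_minus_distrib_mat_vec[OF A])
    then have "u - P *\<^sub>v u = 0\<^sub>v ?n"
      using orth[OF u(1)] dg_inner_self_eq_0[OF dx] Pu[OF u(1)] u(1) by simp
    then have "u - P *\<^sub>v u + P *\<^sub>v u = P *\<^sub>v u" using Pu[OF u(1)] by simp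
    then show ?thesis using minus_add_cancel_vec[OF u(1) Pu[OF u(1)]] by simp
  qed
  have "x = 0\<^sub>v ?n" if x: "x \<in> carrier_vec ?n" and zero: "(?A + P) *\<^sub>v x = 0\<^sub>v ?n" for x
  proof -
    have sum0: "?A *\<^sub>v x + P *\<^sub>v x = 0\<^sub>v ?n"
      using zero add_mult_distrib_mat_vec[OF A P x] by simp
    then have "P *\<^sub>v (?A *\<^sub>v x + P *\<^sub>v x) = 0\<^sub>v ?n" using P by auto
    then have "P *\<^sub>v x = 0\<^sub>v ?n"
      using PA[OF x] fixed[OF Pu[OF x] ker[OF x]] Pu[OF x] Au[OF x]
      by (simp add: mult_add_distrib_mat_vec[OF P])
    moreover from this sum0 have "?A *\<^sub>v x = 0\<^sub>v ?n" using Au[OF x] by simp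
    ultimately show ?thesis using fixed[OF x] by simp
  qed
  then show "minv (?A + P) \<in> carrier_mat ?n ?n" "(?A + P) * minv (?A + P) = 1\<^sub>m ?n"
    using minv_inverse[OF add_carrier_mat[OF P]] by blast+
qed

section \<open>The Poisson residual as a linear map on states\<close>

section \<open>Propagation of the discrete Poisson equation\<close>

text \<open>The two sides of the equation brought together, with the velocity step and the
  projection taken out of the sum, so that the distribution enters only through its velocity
  sum.\<close>

definition poisson_residual ::
  "nat \<Rightarrow> nat \<Rightarrow> real \<Rightarrow> nat \<Rightarrow> real \<Rightarrow> real mat \<Rightarrow> state \<Rightarrow> real vec" where
  "poisson_residual k Nx L0 Nv vmax P U =
     (dg_mat k Nx L0 + P) *\<^sub>v snd U + vel_step Nv vmax \<cdot>\<^sub>v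
       ((1\<^sub>m (dg_dim k Nx) - P) *\<^sub>v vsum (dg_dim k Nx) (fst U) {1..Nv})"

lemma states_carrier:
  assumes "U \<in> states k Nx Nv"
  shows "snd U \<in> carrier_vec (dg_dim k Nx)"
    and "j \<in> {1..Nv} \<Longrightarrow> fst U j \<in> carrier_vec (dg_dim k Nx)"
  using assms by (auto simp: states_def)

lemma states_add:
  "U \<in> states k Nx Nv \<Longrightarrow> W \<in> states k Nx Nv \<Longrightarrow> state_add Nv U W \<in> states k Nx Nv"
  by (auto simp: states_def state_add_def intro!: add_carrier_vec)

lemma states_scale: "U \<in> states k Nx Nv \<Longrightarrow> state_scale Nv t U \<in> states k Nx Nv"
  by (auto simp: states_def state_scale_def)

lemma states_sum: "state_sum k Nx Nv W S \<in> states k Nx Nv"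
  by (auto simp: states_def state_sum_def)

lemma states_exp_lin:
  assumes U: "U \<in> states k Nx Nv"
  shows "exp_lin k Nx L0 Nv vmax P t U \<in> states k Nx Nv"
proof -
  have "mat_exp (c \<cdot>\<^sub>m dg_mat k Nx L0) \<in> carrier_mat (dg_dim k Nx) (dg_dim k Nx)" for c
    by (intro mat_exp_carrier smult_carrier_mat mat_carriers)
  then show ?thesis
    using states_carrier[OF U]
    by (auto simp: states_def exp_lin_def Let_def intro!: mult_mat_vec_carrier add_carrier_vec)
qed

lemma states_nonlin: "nonlin k Nx L0 Nv d U \<in> states k Nx Nv"
  by (auto simp: states_def nonlin_def vel_diff_def field_mat_def
      intro!: mult_mat_vec_carrier[where n = "dg_dim k Nx"])

lemma poisson_residual_add:
  assumes P: "P \<in> carrier_mat (dg_dim k Nx) (dg_dim k Nx)"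
    and U: "U \<in> states k Nx Nv" and W: "W \<in> states k Nx Nv"
  shows "poisson_residual k Nx L0 Nv vmax P (state_add Nv U W)
    = poisson_residual k Nx L0 Nv vmax P U + poisson_residual k Nx L0 Nv vmax P W"
proof -
  let ?n = "dg_dim k Nx" and ?A = "dg_mat k Nx L0"
  have AP: "?A + P \<in> carrier_mat ?n ?n" and Q: "1\<^sub>m ?n - P \<in> carrier_mat ?n ?n"
    using P by auto
  have "vsum ?n (fst (state_add Nv U W)) {1..Nv} = vsum ?n (\<lambda>j. fst U j + fst W j) {1..Nv}"
    by (rule vsum_cong) (simp add: state_add_def)
  also have "\<dots> = vsum ?n (fst U) {1..Nv} + vsum ?n (fst W) {1..Nv}"
    by (intro vsum_add states_carrier(2)[OF U] states_carrier(2)[OF W])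
  finally have fst_eq: "vsum ?n (fst (state_add Nv U W)) {1..Nv}
      = vsum ?n (fst U) {1..Nv} + vsum ?n (fst W) {1..Nv}" .
  have snd_eq: "snd (state_add Nv U W) = snd U + snd W" by (simp add: state_add_def)
  show ?thesis
    unfolding poisson_residual_def fst_eq snd_eq
      mult_add_distrib_mat_vec[OF AP states_carrier(1)[OF U] states_carrier(1)[OF W]]
      mult_add_distrib_mat_vec[OF Q vsum_carrier vsum_carrier]
    by (rule eq_vecI) (use AP Q in \<open>auto simp: algebra_simps\<close>)
qed

lemma poisson_residual_scale:
  assumes P: "P \<in> carrier_mat (dg_dim k Nx) (dg_dim k Nx)" and U: "U \<in> states k Nx Nv"
  shows "poisson_residual k Nx L0 Nv vmax P (state_scale Nv t U)
    = t \<cdot>\<^sub>v poisson_residual k Nx L0 Nv vmax P U"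
proof -
  let ?n = "dg_dim k Nx" and ?A = "dg_mat k Nx L0"
  have AP: "?A + P \<in> carrier_mat ?n ?n" and Q: "1\<^sub>m ?n - P \<in> carrier_mat ?n ?n"
    using P by auto
  have "vsum ?n (fst (state_scale Nv t U)) {1..Nv} = vsum ?n (\<lambda>j. t \<cdot>\<^sub>v fst U j) {1..Nv}"
    by (rule vsum_cong) (simp add: state_scale_def)
  also have "\<dots> = t \<cdot>\<^sub>v vsum ?n (fst U) {1..Nv}"
    by (intro vsum_smult states_carrier(2)[OF U])
  finally have fst_eq: "vsum ?n (fst (state_scale Nv t U)) {1..Nv} = t \<cdot>\<^sub>v vsum ?n (fst U) {1..Nv}" .
  have snd_eq: "snd (state_scale Nv t U) = t \<cdot>\<^sub>v snd U" by (simp add: state_scale_def)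
  show ?thesis
    unfolding poisson_residual_def fst_eq snd_eq mult_mat_vec[OF AP states_carrier(1)[OF U]]
      mult_mat_vec[OF Q vsum_carrier]
    by (rule eq_vecI) (use AP Q in \<open>auto simp: algebra_simps\<close>)
qed

text \<open>Additivity applied one summand at a time; this handles the weighted sum of increments of
  a Runge-Kutta step.\<close>

lemma poisson_residual_sum_eq_0:
  assumes P: "P \<in> carrier_mat (dg_dim k Nx) (dg_dim k Nx)" and "finite S"
    and W: "\<And>q. q \<in> S \<Longrightarrow> W q \<in> states k Nx Nv"
    and zero: "\<And>q. q \<in> S \<Longrightarrow> poisson_residual k Nx L0 Nv vmax P (W q) = 0\<^sub>v (dg_dim k Nx)"
  shows "poisson_residual k Nx L0 Nv vmax P (state_sum k Nx Nv W S) = 0\<^sub>v (dg_dim k Nx)"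
  using \<open>finite S\<close> W zero
proof (induction S rule: finite_induct)
  case empty
  let ?n = "dg_dim k Nx"
  have empty_sum: "vsum ?n w {} = 0\<^sub>v ?n" for w by (rule eq_vecI) auto
  have "vsum ?n (fst (state_sum k Nx Nv W {})) {1..Nv} = vsum ?n (\<lambda>j. 0\<^sub>v ?n) {1..Nv}"
    by (rule vsum_cong) (simp add: state_sum_def empty_sum)
  moreover have "snd (state_sum k Nx Nv W {}) = 0\<^sub>v ?n" by (simp add: state_sum_def empty_sum)
  ultimately show ?case
    by (simp add: poisson_residual_def vsum_zero mult_mat_zero_vec[OF add_carrier_mat[OF P]]
        mult_mat_zero_vec[OF minus_carrier_mat[OF P]])
next
  case (insert q S)
  have "state_sum k Nx Nv W (insert q S) = state_add Nv (W q) (state_sum k Nx Nv W S)"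
  proof -
    have "vsum (dg_dim k Nx) w (insert q S) = w q + vsum (dg_dim k Nx) w S"
      if "w q \<in> carrier_vec (dg_dim k Nx)" for w
      by (rule eq_vecI) (use insert.hyps that in auto)
    moreover have "W q \<in> states k Nx Nv" using insert.prems by simp
    ultimately show ?thesis
      using states_carrier[of "W q" k Nx Nv]
      by (auto simp: state_sum_def state_add_def intro!: restrict_ext)
  qed
  then show ?case
    using insert poisson_residual_add[OF P, of "W q" Nv "state_sum k Nx Nv W S"] by (simp add: states_sum)
qed

text \<open>Multiplying by A + P cancels \<open>minv\<close> in the field increment and leaves the
  part of each distribution lost under the flow. Since P exp(v t A) = P, this loss is exactly what
  is missing from the projected distribution after the flow.\<close>

lemma poisson_residual_exp_lin:
  assumes dx: "0 < cell_size Nx L0"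
    and proj: "orthogonal_projection_onto (dg_inner k Nx L0) (dg_dim k Nx) (mat_kernel (dg_mat k Nx L0)) P"
    and U: "U \<in> states k Nx Nv"
  shows "poisson_residual k Nx L0 Nv vmax P (exp_lin k Nx L0 Nv vmax P t U)
    = poisson_residual k Nx L0 Nv vmax P U"
proof -
  let ?n = "dg_dim k Nx" and ?A = "dg_mat k Nx L0" and ?dv = "vel_step Nv vmax"
  let ?R = "minv (?A + P)" and ?Q = "1\<^sub>m ?n - P" and ?S = "{1..Nv}"
  define e where "e j = mat_exp ((vel Nv vmax j * t) \<cdot>\<^sub>m ?A)" for j
  note A = mat_carriers(5)[of k Nx L0]
  note P = projection_carrier[OF dx proj] and R = dg_mat_add_projection_inverse[OF dx proj]
  have AP: "?A + P \<in> carrier_mat ?n ?n" and Q: "?Q \<in> carrier_mat ?n ?n" using P by auto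
  have e: "e j \<in> carrier_mat ?n ?n" for j
    unfolding e_def by (intro mat_exp_carrier smult_carrier_mat A)
  have Pe: "P * e j = P" for j
    unfolding e_def
    by (rule mult_mat_exp_annihilated[OF P smult_carrier_mat[OF A]])
      (simp add: mult_smult_distrib[OF P A] projection_mult_dg_mat[OF dx proj])
  note f = states_carrier(2)[OF U] and E = states_carrier(1)[OF U]
  let ?ef = "\<lambda>j. e j *\<^sub>v fst U j" and ?g = "\<lambda>j. (1\<^sub>m ?n - e j) *\<^sub>v fst U j"
  have ef: "?ef j \<in> carrier_vec ?n" and g: "?g j \<in> carrier_vec ?n" if "j \<in> ?S" for j
    using mult_mat_vec_carrier[OF e f[OF that]] mult_mat_vec_carrier[OF minus_carrier_mat[OF e] f[OF that]]
    by blast+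
  have fst_eq: "vsum ?n (fst (exp_lin k Nx L0 Nv vmax P t U)) ?S = vsum ?n ?ef ?S"
    by (rule vsum_cong) (simp add: exp_lin_def Let_def e_def)
  \<comment> \<open>The inverse is taken out of the velocity sum so that A + P can cancel it
    once.\<close>
  have snd_eq: "snd (exp_lin k Nx L0 Nv vmax P t U) = snd U + ?dv \<cdot>\<^sub>v (?R *\<^sub>v vsum ?n ?g ?S)"
    using mult_mat_vsum[OF R(1), of ?S ?g] g by (simp add: exp_lin_def Let_def e_def)
  have "(?A + P) *\<^sub>v (?R *\<^sub>v vsum ?n ?g ?S) = vsum ?n ?g ?S"
    using assoc_mult_mat_vec[OF AP R(1), of "vsum ?n ?g ?S"] by (simp add: R(2))
  then have field: "(?A + P) *\<^sub>v (snd U + ?dv \<cdot>\<^sub>v (?R *\<^sub>v vsum ?n ?g ?S))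
      = (?A + P) *\<^sub>v snd U + ?dv \<cdot>\<^sub>v vsum ?n ?g ?S"
    using mult_mat_vec_carrier[OF R(1)] E
    by (simp add: mult_add_distrib_mat_vec[OF AP] mult_mat_vec[OF AP])
  \<comment> \<open>For each velocity the terms telescope: (f - ef) + (ef - Pf) = f - Pf, where
    P(ef) has been replaced by Pf.\<close>
  have "vsum ?n ?g ?S + ?Q *\<^sub>v vsum ?n ?ef ?S = vsum ?n (\<lambda>j. ?g j + ?Q *\<^sub>v ?ef j) ?S"
    by (subst mult_mat_vsum[OF Q ef], assumption, rule vsum_add[symmetric])
      (intro g mult_mat_vec_carrier[OF Q] ef, assumption)+
  also have "\<dots> = vsum ?n (\<lambda>j. ?Q *\<^sub>v fst U j) ?S"
  proof (rule vsum_cong)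
    fix j assume j: "j \<in> ?S"
    have "P *\<^sub>v ?ef j = P *\<^sub>v fst U j"
      using assoc_mult_mat_vec[OF P e f[OF j], of j] Pe by simp
    then have "?g j + ?Q *\<^sub>v ?ef j = (fst U j - ?ef j) + (?ef j - P *\<^sub>v fst U j)"
      and "?Q *\<^sub>v fst U j = fst U j - P *\<^sub>v fst U j"
      using f[OF j] ef[OF j]
      by (simp_all add: minus_mult_distrib_mat_vec[OF one_carrier_mat e]
          minus_mult_distrib_mat_vec[OF one_carrier_mat P])
    then show "?g j + ?Q *\<^sub>v ?ef j = ?Q *\<^sub>v fst U j"
      using minus_add_minus_vec[OF f[OF j] ef[OF j] mult_mat_vec_carrier[OF P f[OF j]]]
      by (simp only:)
  qed
  also have "\<dots> = ?Q *\<^sub>v vsum ?n (fst U) ?S"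
    by (rule mult_mat_vsum[OF Q f, symmetric])
  finally have charge: "vsum ?n ?g ?S + ?Q *\<^sub>v vsum ?n ?ef ?S = ?Q *\<^sub>v vsum ?n (fst U) ?S" .
  have "poisson_residual k Nx L0 Nv vmax P (exp_lin k Nx L0 Nv vmax P t U)
      = (?A + P) *\<^sub>v snd U + ?dv \<cdot>\<^sub>v (vsum ?n ?g ?S + ?Q *\<^sub>v vsum ?n ?ef ?S)"
    unfolding poisson_residual_def fst_eq snd_eq field
    by (rule eq_vecI) (use P in \<open>auto simp: algebra_simps\<close>)
  then show ?thesis unfolding charge poisson_residual_def .
qed

text \<open>The field matrix is the same for every velocity and comes out of the sum, where
  conservativity leaves zero; the field component is zero by definition. The state itself need not
  satisfy the Poisson equation.\<close>

lemma poisson_residual_nonlin: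
  assumes P: "P \<in> carrier_mat (dg_dim k Nx) (dg_dim k Nx)"
    and cons: "conservative k Nx Nv d" and U: "U \<in> states k Nx Nv"
  shows "poisson_residual k Nx L0 Nv vmax P (nonlin k Nx L0 Nv d U) = 0\<^sub>v (dg_dim k Nx)"
proof -
  let ?n = "dg_dim k Nx" and ?F = "field_mat k Nx L0 (snd U)"
  let ?D = "vel_diff k Nx Nv d (fst U)"
  have F: "- ?F \<in> carrier_mat ?n ?n" by (simp add: field_mat_def)
  have D: "?D j \<in> carrier_vec ?n" for j by (simp add: vel_diff_def)
  have "vsum ?n (fst (nonlin k Nx L0 Nv d U)) {1..Nv} = vsum ?n (\<lambda>j. (- ?F) *\<^sub>v ?D j) {1..Nv}"
  proof (rule vsum_cong)
    fix j assume "j \<in> {1..Nv}"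
    then show "fst (nonlin k Nx L0 Nv d U) j = (- ?F) *\<^sub>v ?D j"
      using F carrier_vecD[OF D, of j] by (simp add: nonlin_def uminus_mult_mat_vec)
  qed
  also have "\<dots> = (- ?F) *\<^sub>v vsum ?n ?D {1..Nv}"
    using mult_mat_vsum[OF F D] by simp
  also have "vsum ?n ?D {1..Nv} = 0\<^sub>v ?n"
    using cons U by (auto simp: conservative_def states_def)
  finally have "vsum ?n (fst (nonlin k Nx L0 Nv d U)) {1..Nv} = 0\<^sub>v ?n"
    using F by auto
  then show ?thesis
    by (simp add: poisson_residual_def nonlin_def mult_mat_zero_vec[OF add_carrier_mat[OF P]]
        mult_mat_zero_vec[OF minus_carrier_mat[OF P]])
qed

section \<open>From the residual to the equation, and single Lawson steps\<close>

lemma discrete_poisson_iff_residual: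
  assumes P: "P \<in> carrier_mat (dg_dim k Nx) (dg_dim k Nx)" and U: "U \<in> states k Nx Nv"
  shows "discrete_poisson k Nx L0 Nv vmax P U
    \<longleftrightarrow> poisson_residual k Nx L0 Nv vmax P U = 0\<^sub>v (dg_dim k Nx)"
proof -
  let ?n = "dg_dim k Nx" and ?x = "(dg_mat k Nx L0 + P) *\<^sub>v snd U"
  let ?y = "vel_step Nv vmax \<cdot>\<^sub>v ((1\<^sub>m (dg_dim k Nx) - P) *\<^sub>v vsum (dg_dim k Nx) (fst U) {1..Nv})"
  have Q: "1\<^sub>m ?n - P \<in> carrier_mat ?n ?n" using P by auto
  have xy: "?x \<in> carrier_vec ?n" "?y \<in> carrier_vec ?n"
    using P Q mult_mat_vec_carrier[OF add_carrier_mat[OF P] states_carrier(1)[OF U]] by auto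
  have "vsum ?n (\<lambda>j. vel_step Nv vmax \<cdot>\<^sub>v ((1\<^sub>m ?n - P) *\<^sub>v fst U j)) {1..Nv} = ?y"
    by (subst mult_mat_vsum[OF Q states_carrier(2)[OF U]], assumption, rule vsum_smult)
      (intro mult_mat_vec_carrier[OF Q] states_carrier(2)[OF U])
  then have "discrete_poisson k Nx L0 Nv vmax P U \<longleftrightarrow> ?x = - ?y"
    by (simp add: discrete_poisson_def)
  also have "\<dots> \<longleftrightarrow> ?x + ?y = 0\<^sub>v ?n"
  proof
    assume "?x + ?y = 0\<^sub>v ?n"
    then have "(?x + ?y) + (- ?y) = - ?y" using xy by simp
    then show "?x = - ?y" using xy by (simp add: assoc_add_vec[where n = ?n])
  qed (use xy in simp)
  finally show ?thesis by (simp add: poisson_residual_def)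
qed

text \<open>Scale and flow time are arbitrary, so this covers the Euler increment and each weighted
  Runge-Kutta increment.\<close>

lemma lawson_increment_residual:
  assumes dx: "0 < cell_size Nx L0"
    and proj: "orthogonal_projection_onto (dg_inner k Nx L0) (dg_dim k Nx) (mat_kernel (dg_mat k Nx L0)) P"
    and cons: "conservative k Nx Nv d" and U: "U \<in> states k Nx Nv"
  shows "poisson_residual k Nx L0 Nv vmax P (state_scale Nv r
      (exp_lin k Nx L0 Nv vmax P t (nonlin k Nx L0 Nv d U))) = 0\<^sub>v (dg_dim k Nx)"
proof -
  note P = projection_carrier[OF dx proj]
  have "poisson_residual k Nx L0 Nv vmax P (exp_lin k Nx L0 Nv vmax P t (nonlin k Nx L0 Nv d U))
      = 0\<^sub>v (dg_dim k Nx)"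
    unfolding poisson_residual_exp_lin[OF dx proj states_nonlin]
    by (rule poisson_residual_nonlin[OF P cons U])
  then show ?thesis
    by (simp add: poisson_residual_scale[OF P states_exp_lin[OF states_nonlin]])
qed

lemma lawson_euler_step_residual:
  assumes dx: "0 < cell_size Nx L0"
    and proj: "orthogonal_projection_onto (dg_inner k Nx L0) (dg_dim k Nx) (mat_kernel (dg_mat k Nx L0)) P"
    and cons: "conservative k Nx Nv d" and U: "U \<in> states k Nx Nv"
    and zero: "poisson_residual k Nx L0 Nv vmax P U = 0\<^sub>v (dg_dim k Nx)"
    and step: "lawson_euler_step k Nx L0 Nv vmax d P dt U U'"
  shows "U' \<in> states k Nx Nv \<and> poisson_residual k Nx L0 Nv vmax P U' = 0\<^sub>v (dg_dim k Nx)"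
  using step unfolding lawson_euler_step_def
  by (simp add: states_add states_scale states_exp_lin[OF U] states_exp_lin[OF states_nonlin]
      poisson_residual_add[OF projection_carrier[OF dx proj] states_exp_lin[OF U]]
      poisson_residual_exp_lin[OF dx proj U] zero lawson_increment_residual[OF dx proj cons U])

text \<open>The linear flow carries over the zero residual of \<open>U\<close>, and every weighted
  increment adds a zero residual.\<close>

lemma lawson_rk_step_residual:
  assumes dx: "0 < cell_size Nx L0"
    and proj: "orthogonal_projection_onto (dg_inner k Nx L0) (dg_dim k Nx) (mat_kernel (dg_mat k Nx L0)) P"
    and cons: "conservative k Nx Nv d" and U: "U \<in> states k Nx Nv"
    and zero: "poisson_residual k Nx L0 Nv vmax P U = 0\<^sub>v (dg_dim k Nx)"
    and step: "lawson_rk_step k Nx L0 Nv vmax d P s a b c dt U U'"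
  shows "U' \<in> states k Nx Nv \<and> poisson_residual k Nx L0 Nv vmax P U' = 0\<^sub>v (dg_dim k Nx)"
proof -
  note P = projection_carrier[OF dx proj]
  obtain V where
    V: "\<And>p. p \<in> {1..s} \<Longrightarrow> V p = state_add Nv (exp_lin k Nx L0 Nv vmax P (c p * dt) U)
        (state_scale Nv dt (state_sum k Nx Nv (\<lambda>q. state_scale Nv (a p q)
          (exp_lin k Nx L0 Nv vmax P ((c p - c q) * dt) (nonlin k Nx L0 Nv d (V q)))) {1..<p}))"
    and U': "U' = state_add Nv (exp_lin k Nx L0 Nv vmax P dt U)
        (state_scale Nv dt (state_sum k Nx Nv (\<lambda>p. state_scale Nv (b p)
          (exp_lin k Nx L0 Nv vmax P ((1 - c p) * dt) (nonlin k Nx L0 Nv d (V p)))) {1..s}))"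
    using step unfolding lawson_rk_step_def by blast
  let ?I = "\<lambda>p. state_scale Nv (b p)
    (exp_lin k Nx L0 Nv vmax P ((1 - c p) * dt) (nonlin k Nx L0 Nv d (V p)))"
  \<comment> \<open>Membership in \<open>states\<close> is all that is required of the stages,
    because the nonlinear term has zero residual at any state.\<close>
  have V_states: "V p \<in> states k Nx Nv" if "p \<in> {1..s}" for p
    unfolding V[OF that] by (intro states_add states_exp_lin[OF U] states_scale states_sum)
  have "poisson_residual k Nx L0 Nv vmax P (state_sum k Nx Nv ?I {1..s}) = 0\<^sub>v (dg_dim k Nx)"
    by (intro poisson_residual_sum_eq_0[OF P] finite_atLeastAtMost states_scale states_exp_lin
        states_nonlin lawson_increment_residual[OF dx proj cons] V_states)
  then have "poisson_residual k Nx L0 Nv vmax P U' = 0\<^sub>v (dg_dim k Nx)"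
    unfolding U'
    by (simp add: poisson_residual_add[OF P states_exp_lin[OF U] states_scale[OF states_sum]]
        poisson_residual_exp_lin[OF dx proj U] zero poisson_residual_scale[OF P states_sum])
  moreover have "U' \<in> states k Nx Nv"
    unfolding U' by (intro states_add states_exp_lin[OF U] states_scale states_sum)
  ultimately show ?thesis by blast
qed

theorem proposition3:
  fixes k Nx Nv s :: nat
    and L0 vmax dt :: real
    and d a :: "nat \<Rightarrow> nat \<Rightarrow> real"
    and b c :: "nat \<Rightarrow> real"
    and P :: "real mat"
    and U :: "nat \<Rightarrow> state"
  assumes "Nx \<ge> 1" and "L0 > 0" and "Nv \<ge> 1" and "vmax > 0" and "dt > 0"
    and projection:
      "orthogonal_projection_onto (dg_inner k Nx L0) (dg_dim k Nx) (mat_kernel (dg_mat k Nx L0)) P"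
    and "conservative k Nx Nv d"
    and "U 0 \<in> states k Nx Nv"
    and scheme:
      "(\<forall>n. lawson_euler_step k Nx L0 Nv vmax d P dt (U n) (U (Suc n))) \<or>
       (\<forall>n. lawson_rk_step k Nx L0 Nv vmax d P s a b c dt (U n) (U (Suc n)))"
    and initial: "discrete_poisson k Nx L0 Nv vmax P (U 0)"
  shows "\<forall>n\<ge>1. discrete_poisson k Nx L0 Nv vmax P (U n)"
proof -
  have dx: "0 < cell_size Nx L0" using cell_size_pos assms(1,2) by blast
  note P = projection_carrier[OF dx projection]
  \<comment> \<open>Membership in \<open>states\<close> is carried through the induction, since
    linearity of the residual relies on the dimensions it records.\<close>
  have "U n \<in> states k Nx Nv \<and> poisson_residual k Nx L0 Nv vmax P (U n) = 0\<^sub>v (dg_dim k Nx)" for n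
  proof (induction n)
    case 0
    then show ?case
      using \<open>U 0 \<in> states k Nx Nv\<close> initial discrete_poisson_iff_residual[OF P] by blast
  next
    case (Suc n)
    then show ?case
      using scheme lawson_euler_step_residual[OF dx projection \<open>conservative k Nx Nv d\<close>]
        lawson_rk_step_residual[OF dx projection \<open>conservative k Nx Nv d\<close>] by blast
  qed
  then show ?thesis using discrete_poisson_iff_residual[OF P] by blast
qed

end
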